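(* For an additive symmetric monoidal category, there is a bijective correspondence between the following: (i) monoidal coalgebra modalities; (ii) additive bialgebra modalities; (iii) monoidal bialgebra modalities.
   Context: Conventions: composition is written diagrammatically, $f;g$ means first $f$ then $g$. Symmetric monoidal categories are taken to be strict, with product $\otimes$, unit $I$, symmetry $\sigma_{A,B}:A\otimes B\to B\otimes A$. Additive category: each homset is a commutative monoid $(+,0)$ with $f;(g+h)=f;g+f;h$, $f;0=0$, $(g+h);k=g;k+h;k$, $0;k=0$. Additive symmetric monoidal category: a symmetric monoidal category that is additive and satisfies $f\otimes(g+h)=f\otimes g+f\otimes h$, $f\otimes 0=0$, $(g+h)\otimes k=g\otimes k+h\otimes k$, $0\otimes k=0$. Coalgebra modality $(!,\delta,\varepsilon,\Delta,\mathsf{e})$: a comonad $(!,\delta,\varepsilon)$, with $\delta_A:!(A)\to!!(A)$, $\varepsilon_A:!(A)\to A$, together with natural transformations $\Delta_A:!(A)\to!(A)\otimes!(A)$, $\mathsf{e}_A:!(A)\to I$ such that each $(!(A),\Delta_A,\mathsf{e}_A)$ is a cocommutative comonoid and $\delta_A$ is a comonoid morphism: $\delta_A;\Delta_{!(A)}=\Delta_A;(\delta_A\otimes\delta_A)$, $\delta_A;\mathsf{e}_{!(A)}=\mathsf{e}_A$. Monoidal coalgebra modality $(!,\delta,\varepsilon,\Delta,\mathsf{e},\mathsf{m},\mathsf{m}_I)$: a coalgebra modality with a natural transformation $\mathsf{m}_{A,B}:!(A)\otimes!(B)\to!(A\otimes B)$ and a map $\mathsf{m}_I:I\to!(I)$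 making $!$ a symmetric (lax) monoidal endofunctor, such that - $\mathsf{m}_{A,B};\delta_{A\otimes B}=(\delta_A\otimes\delta_B);\mathsf{m}_{!(A),!(B)};!(\mathsf{m}_{A,B})$, $\mathsf{m}_I;\delta_I=\mathsf{m}_I;!(\mathsf{m}_I)$, $\mathsf{m}_{A,B};\varepsilon_{A\otimes B}=\varepsilon_A\otimes\varepsilon_B$, $\mathsf{m}_I;\varepsilon_I=1_I$; - $\mathsf{m}_{A,B};\Delta_{A\otimes B}=(\Delta_A\otimes\Delta_B);(1\otimes\sigma_{!(A),!(B)}\otimes1);(\mathsf{m}_{A,B}\otimes\mathsf{m}_{A,B})$, $\mathsf{m}_{A,B};\mathsf{e}_{A\otimes B}=\mathsf{e}_A\otimes\mathsf{e}_B$, $\mathsf{m}_I;\Delta_I=\mathsf{m}_I\otimes\mathsf{m}_I$, $\mathsf{m}_I;\mathsf{e}_I=1_I$; - $\delta_A;!(\Delta_A)=\Delta_A;(\delta_A\otimes\delta_A);\mathsf{m}_{!(A),!(A)}$, $\delta_A;!(\mathsf{e}_A)=\mathsf{e}_A;\mathsf{m}_I$. Bialgebra modality $(!,\delta,\varepsilon,\Delta,\mathsf{e},\nabla,\mathsf{u})$: a coalgebra modality with natural transformations $\nabla_A:!(A)\otimes!(A)\to!(A)$, $\mathsf{u}_A:I\to!(A)$ such that each $(!(A),\nabla_A,\mathsf{u}_A)$ is a commutative monoid and $(!(A),\nabla_A,\mathsf{u}_A,\Delta_A,\mathsf{e}_A)$ is a bimonoid. Additive bialgebra modality (on an additive symmetric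 monoidal category): a bialgebra modality such that $\nabla_A;\varepsilon_A=(\mathsf{e}_A\otimes\varepsilon_A)+(\varepsilon_A\otimes\mathsf{e}_A)$, $\mathsf{u}_A;\varepsilon_A=0$, $!(f+g)=\Delta_A;(!(f)\otimes!(g));\nabla_B$ for all $f,g:A\to B$, and $!(0)=\mathsf{e}_A;\mathsf{u}_B$ for $0:A\to B$. Monoidal bialgebra modality $(!,\delta,\varepsilon,\Delta,\mathsf{e},\mathsf{m},\mathsf{m}_I,\nabla,\mathsf{u})$: both a monoidal coalgebra modality and a bialgebra modality (on the same coalgebra modality) such that - $(1_{!(A)}\otimes\nabla_B);\mathsf{m}_{A,B}=(\Delta_A\otimes1\otimes1);(1\otimes\sigma_{!(A),!(B)}\otimes1);(\mathsf{m}_{A,B}\otimes\mathsf{m}_{A,B});\nabla_{A\otimes B}$; - $(\nabla_A\otimes1_{!(B)});\mathsf{m}_{A,B}=(1\otimes1\otimes\Delta_B);(1\otimes\sigma_{!(A),!(B)}\otimes1);(\mathsf{m}_{A,B}\otimes\mathsf{m}_{A,B});\nabla_{A\otimes B}$; - $(\mathsf{u}_A\otimes1_{!(B)});\mathsf{m}_{A,B}=\mathsf{e}_B;\mathsf{u}_{A\otimes B}$, $(1_{!(A)}\otimes\mathsf{u}_B);\mathsf{m}_{A,B}=\mathsf{e}_A;\mathsf{u}_{A\otimes B}$; - $\nabla_A;\delta_A=(\delta_A\otimes\delta_A);\mathsf{m}_{!(A),!(A)};!(\nabla_A)$, $\mathsf{u}_A;\delta_A=\mathsf{m}_I;!(\mathsf{u}_A)$.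 *)

theory Defs
  imports Main
begin

text \<open>
  A category is presented by a type of objects, a type of arrows with total source and target
  maps, and a composition whose values matter only on composable pairs (likewise the sum of arrows
  matters only on parallel pairs). Every object and every arrow of the ambient types belongs to
  the category, so a family of arrows indexed by objects is just a HOL function, and two such
  families are equal as functions iff they are equal as families. Hence no extensionality side
  conditions are needed to speak of sets of structures on a category and of bijections between
  them. Strictness of the tensor product is literal equality of objects and of arrows.
  Composition \<open>f \<Zsemi> g\<close> is diagrammatic.
\<close>

record ('o, 'm) smc =
  source :: "'m \<Rightarrow> 'o"
  target :: "'m \<Rightarrow> 'o"
  ident :: "'o \<Rightarrow> 'm" (\<open>\<one>\<index>\<close>)
  seq :: "'m \<Rightarrow> 'm \<Rightarrow> 'm" (infixl \<open>\<Zsemi>\<index>\<close> 60)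
  tensor_obj :: "'o \<Rightarrow> 'o \<Rightarrow> 'o" (infixr \<open>\<otimes>\<^sub>0\<index>\<close> 70)
  tensor :: "'m \<Rightarrow> 'm \<Rightarrow> 'm" (infixr \<open>\<otimes>\<index>\<close> 70)
  unit_obj :: 'o (\<open>\<I>\<index>\<close>)
  symm :: "'o \<Rightarrow> 'o \<Rightarrow> 'm" (\<open>\<sigma>\<index>\<close>)

record ('o, 'm) additive_smc = "('o, 'm) smc" +
  add :: "'m \<Rightarrow> 'm \<Rightarrow> 'm" (infixl \<open>\<oplus>\<index>\<close> 55)
  zero :: "'o \<Rightarrow> 'o \<Rightarrow> 'm" (\<open>\<zero>\<index>\<close>)

definition in_hom :: "('o, 'm, 'x) smc_scheme \<Rightarrow> 'm \<Rightarrow> 'o \<Rightarrow> 'o \<Rightarrow> bool"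
    (\<open>\<guillemotleft>_ :\<index> _ \<rightarrow> _\<guillemotright>\<close>)
  where "in_hom C f A B \<longleftrightarrow> source C f = A \<and> target C f = B"

locale symmetric_monoidal_category =
  fixes C :: "('o, 'm, 'x) smc_scheme" (structure)
  assumes ident_in_hom: "\<guillemotleft>\<one> A : A \<rightarrow> A\<guillemotright>"
    and seq_in_hom: "\<guillemotleft>f : X \<rightarrow> Y\<guillemotright> \<Longrightarrow> \<guillemotleft>g : Y \<rightarrow> Z\<guillemotright> \<Longrightarrow> \<guillemotleft>f \<Zsemi> g : X \<rightarrow> Z\<guillemotright>"
    and seq_ident_left: "\<guillemotleft>f : X \<rightarrow> Y\<guillemotright> \<Longrightarrow> \<one> X \<Zsemi> f = f"
    and seq_ident_right: "\<guillemotleft>f : X \<rightarrow> Y\<guillemotright> \<Longrightarrow> f \<Zsemi> \<one> Y = f"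
    and seq_assoc: "\<guillemotleft>f : X \<rightarrow> Y\<guillemotright> \<Longrightarrow> \<guillemotleft>g : Y \<rightarrow> Z\<guillemotright> \<Longrightarrow> \<guillemotleft>h : Z \<rightarrow> W\<guillemotright>
        \<Longrightarrow> (f \<Zsemi> g) \<Zsemi> h = f \<Zsemi> (g \<Zsemi> h)"
    and tensor_in_hom: "\<guillemotleft>f : X \<rightarrow> Y\<guillemotright> \<Longrightarrow> \<guillemotleft>g : Z \<rightarrow> W\<guillemotright> \<Longrightarrow> \<guillemotleft>f \<otimes> g : X \<otimes>\<^sub>0 Z \<rightarrow> Y \<otimes>\<^sub>0 W\<guillemotright>"
    and tensor_ident: "\<one> A \<otimes> \<one> B = \<one> (A \<otimes>\<^sub>0 B)"
    and tensor_seq: "\<guillemotleft>f : X \<rightarrow> Y\<guillemotright> \<Longrightarrow> \<guillemotleft>g : Y \<rightarrow> Z\<guillemotright> \<Longrightarrow> \<guillemotleft>h : X' \<rightarrow> Y'\<guillemotright> \<Longrightarrow> \<guillemotleft>k : Y' \<rightarrow> Z'\<guillemotright>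
        \<Longrightarrow> (f \<Zsemi> g) \<otimes> (h \<Zsemi> k) = (f \<otimes> h) \<Zsemi> (g \<otimes> k)"
    and tensor_obj_assoc: "(X \<otimes>\<^sub>0 Y) \<otimes>\<^sub>0 Z = X \<otimes>\<^sub>0 (Y \<otimes>\<^sub>0 Z)"
    and tensor_obj_unit_left: "\<I> \<otimes>\<^sub>0 X = X"
    and tensor_obj_unit_right: "X \<otimes>\<^sub>0 \<I> = X"
    and tensor_assoc: "(f \<otimes> g) \<otimes> h = f \<otimes> (g \<otimes> h)"
    and tensor_unit_left: "\<one> \<I> \<otimes> f = f"
    and tensor_unit_right: "f \<otimes> \<one> \<I> = f"
    and symm_in_hom: "\<guillemotleft>\<sigma> A B : A \<otimes>\<^sub>0 B \<rightarrow> B \<otimes>\<^sub>0 A\<guillemotright>"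
    and symm_natural: "\<guillemotleft>f : X \<rightarrow> Y\<guillemotright> \<Longrightarrow> \<guillemotleft>g : Z \<rightarrow> W\<guillemotright>
        \<Longrightarrow> (f \<otimes> g) \<Zsemi> \<sigma> Y W = \<sigma> X Z \<Zsemi> (g \<otimes> f)"
    and symm_involutive: "\<sigma> A B \<Zsemi> \<sigma> B A = \<one> (A \<otimes>\<^sub>0 B)"
    and symm_hexagon: "\<sigma> X (Y \<otimes>\<^sub>0 Z) = (\<sigma> X Y \<otimes> \<one> Z) \<Zsemi> (\<one> Y \<otimes> \<sigma> X Z)"

locale additive_symmetric_monoidal_category =
  symmetric_monoidal_category C for C :: "('o, 'm, 'x) additive_smc_scheme" (structure) +
  assumes add_in_hom: "\<guillemotleft>f : X \<rightarrow> Y\<guillemotright> \<Longrightarrow> \<guillemotleft>g : X \<rightarrow> Y\<guillemotright> \<Longrightarrow> \<guillemotleft>f \<oplus> g : X \<rightarrow> Y\<guillemotright>"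
    and zero_in_hom: "\<guillemotleft>\<zero> X Y : X \<rightarrow> Y\<guillemotright>"
    and add_assoc: "\<guillemotleft>f : X \<rightarrow> Y\<guillemotright> \<Longrightarrow> \<guillemotleft>g : X \<rightarrow> Y\<guillemotright> \<Longrightarrow> \<guillemotleft>h : X \<rightarrow> Y\<guillemotright>
        \<Longrightarrow> (f \<oplus> g) \<oplus> h = f \<oplus> (g \<oplus> h)"
    and add_commute: "\<guillemotleft>f : X \<rightarrow> Y\<guillemotright> \<Longrightarrow> \<guillemotleft>g : X \<rightarrow> Y\<guillemotright> \<Longrightarrow> f \<oplus> g = g \<oplus> f"
    and add_zero: "\<guillemotleft>f : X \<rightarrow> Y\<guillemotright> \<Longrightarrow> f \<oplus> \<zero> X Y = f"
    and seq_add: "\<guillemotleft>f : X \<rightarrow> Y\<guillemotright> \<Longrightarrow> \<guillemotleft>g : Y \<rightarrow> Z\<guillemotright> \<Longrightarrow> \<guillemotleft>h : Y \<rightarrow> Z\<guillemotright>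
        \<Longrightarrow> f \<Zsemi> (g \<oplus> h) = (f \<Zsemi> g) \<oplus> (f \<Zsemi> h)"
    and seq_zero: "\<guillemotleft>f : X \<rightarrow> Y\<guillemotright> \<Longrightarrow> f \<Zsemi> \<zero> Y Z = \<zero> X Z"
    and add_seq: "\<guillemotleft>g : X \<rightarrow> Y\<guillemotright> \<Longrightarrow> \<guillemotleft>h : X \<rightarrow> Y\<guillemotright> \<Longrightarrow> \<guillemotleft>k : Y \<rightarrow> Z\<guillemotright>
        \<Longrightarrow> (g \<oplus> h) \<Zsemi> k = (g \<Zsemi> k) \<oplus> (h \<Zsemi> k)"
    and zero_seq: "\<guillemotleft>k : Y \<rightarrow> Z\<guillemotright> \<Longrightarrow> \<zero> X Y \<Zsemi> k = \<zero> X Z"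
    and tensor_add: "\<guillemotleft>f : X \<rightarrow> Y\<guillemotright> \<Longrightarrow> \<guillemotleft>g : Z \<rightarrow> W\<guillemotright> \<Longrightarrow> \<guillemotleft>h : Z \<rightarrow> W\<guillemotright>
        \<Longrightarrow> f \<otimes> (g \<oplus> h) = (f \<otimes> g) \<oplus> (f \<otimes> h)"
    and tensor_zero: "\<guillemotleft>f : X \<rightarrow> Y\<guillemotright> \<Longrightarrow> f \<otimes> \<zero> Z W = \<zero> (X \<otimes>\<^sub>0 Z) (Y \<otimes>\<^sub>0 W)"
    and add_tensor: "\<guillemotleft>g : X \<rightarrow> Y\<guillemotright> \<Longrightarrow> \<guillemotleft>h : X \<rightarrow> Y\<guillemotright> \<Longrightarrow> \<guillemotleft>k : Z \<rightarrow> W\<guillemotright>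
        \<Longrightarrow> (g \<oplus> h) \<otimes> k = (g \<otimes> k) \<oplus> (h \<otimes> k)"
    and zero_tensor: "\<guillemotleft>k : Z \<rightarrow> W\<guillemotright> \<Longrightarrow> \<zero> X Y \<otimes> k = \<zero> (X \<otimes>\<^sub>0 Z) (Y \<otimes>\<^sub>0 W)"

text \<open>
  The endofunctor \<open>!\<close> is given by its object part \<open>bang\<^sub>0\<close> and its arrow part \<open>bang\<close>.
\<close>

locale coalgebra_modality =
  symmetric_monoidal_category C for C :: "('o, 'm, 'x) smc_scheme" (structure) +
  fixes bang\<^sub>0 :: "'o \<Rightarrow> 'o"
    and bang :: "'m \<Rightarrow> 'm"
    and \<delta> \<epsilon> \<Delta> e :: "'o \<Rightarrow> 'm"
  assumes bang_in_hom: "\<guillemotleft>f : X \<rightarrow> Y\<guillemotright> \<Longrightarrow> \<guillemotleft>bang f : bang\<^sub>0 X \<rightarrow> bang\<^sub>0 Y\<guillemotright>"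
    and bang_ident: "bang (\<one> A) = \<one> (bang\<^sub>0 A)"
    and bang_seq: "\<guillemotleft>f : X \<rightarrow> Y\<guillemotright> \<Longrightarrow> \<guillemotleft>g : Y \<rightarrow> Z\<guillemotright> \<Longrightarrow> bang (f \<Zsemi> g) = bang f \<Zsemi> bang g"
    \<comment> \<open>comonad\<close>
    and delta_in_hom: "\<guillemotleft>\<delta> A : bang\<^sub>0 A \<rightarrow> bang\<^sub>0 (bang\<^sub>0 A)\<guillemotright>"
    and delta_natural: "\<guillemotleft>f : X \<rightarrow> Y\<guillemotright> \<Longrightarrow> bang f \<Zsemi> \<delta> Y = \<delta> X \<Zsemi> bang (bang f)"
    and eps_in_hom: "\<guillemotleft>\<epsilon> A : bang\<^sub>0 A \<rightarrow> A\<guillemotright>"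
    and eps_natural: "\<guillemotleft>f : X \<rightarrow> Y\<guillemotright> \<Longrightarrow> bang f \<Zsemi> \<epsilon> Y = \<epsilon> X \<Zsemi> f"
    and delta_delta: "\<delta> A \<Zsemi> \<delta> (bang\<^sub>0 A) = \<delta> A \<Zsemi> bang (\<delta> A)"
    and delta_eps: "\<delta> A \<Zsemi> \<epsilon> (bang\<^sub>0 A) = \<one> (bang\<^sub>0 A)"
    and delta_bang_eps: "\<delta> A \<Zsemi> bang (\<epsilon> A) = \<one> (bang\<^sub>0 A)"
    \<comment> \<open>natural cocommutative comonoids\<close>
    and Delta_in_hom: "\<guillemotleft>\<Delta> A : bang\<^sub>0 A \<rightarrow> bang\<^sub>0 A \<otimes>\<^sub>0 bang\<^sub>0 A\<guillemotright>"
    and Delta_natural: "\<guillemotleft>f : X \<rightarrow> Y\<guillemotright> \<Longrightarrow> bang f \<Zsemi> \<Delta> Y = \<Delta> X \<Zsemi> (bang f \<otimes> bang f)"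
    and e_in_hom: "\<guillemotleft>e A : bang\<^sub>0 A \<rightarrow> \<I>\<guillemotright>"
    and e_natural: "\<guillemotleft>f : X \<rightarrow> Y\<guillemotright> \<Longrightarrow> bang f \<Zsemi> e Y = e X"
    and Delta_coassoc: "\<Delta> A \<Zsemi> (\<Delta> A \<otimes> \<one> (bang\<^sub>0 A)) = \<Delta> A \<Zsemi> (\<one> (bang\<^sub>0 A) \<otimes> \<Delta> A)"
    and Delta_counit_left: "\<Delta> A \<Zsemi> (e A \<otimes> \<one> (bang\<^sub>0 A)) = \<one> (bang\<^sub>0 A)"
    and Delta_counit_right: "\<Delta> A \<Zsemi> (\<one> (bang\<^sub>0 A) \<otimes> e A) = \<one> (bang\<^sub>0 A)"
    and Delta_cocomm: "\<Delta> A \<Zsemi> \<sigma> (bang\<^sub>0 A) (bang\<^sub>0 A) = \<Delta> A"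
    \<comment> \<open>\<open>\<delta>\<close> is a comonoid morphism\<close>
    and delta_Delta: "\<delta> A \<Zsemi> \<Delta> (bang\<^sub>0 A) = \<Delta> A \<Zsemi> (\<delta> A \<otimes> \<delta> A)"
    and delta_e: "\<delta> A \<Zsemi> e (bang\<^sub>0 A) = e A"

locale monoidal_coalgebra_modality =
  coalgebra_modality C bang\<^sub>0 bang \<delta> \<epsilon> \<Delta> e
  for C :: "('o, 'm, 'x) smc_scheme" (structure) and bang\<^sub>0 bang \<delta> \<epsilon> \<Delta> e +
  fixes m :: "'o \<Rightarrow> 'o \<Rightarrow> 'm" and m\<^sub>I :: 'm
    \<comment> \<open>symmetric lax monoidal endofunctor\<close>
  assumes m_in_hom: "\<guillemotleft>m A B : bang\<^sub>0 A \<otimes>\<^sub>0 bang\<^sub>0 B \<rightarrow> bang\<^sub>0 (A \<otimes>\<^sub>0 B)\<guillemotright>"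
    and m_natural: "\<guillemotleft>f : X \<rightarrow> Y\<guillemotright> \<Longrightarrow> \<guillemotleft>g : Z \<rightarrow> W\<guillemotright>
        \<Longrightarrow> (bang f \<otimes> bang g) \<Zsemi> m Y W = m X Z \<Zsemi> bang (f \<otimes> g)"
    and mI_in_hom: "\<guillemotleft>m\<^sub>I : \<I> \<rightarrow> bang\<^sub>0 \<I>\<guillemotright>"
    and m_assoc: "(m X Y \<otimes> \<one> (bang\<^sub>0 Z)) \<Zsemi> m (X \<otimes>\<^sub>0 Y) Z
        = (\<one> (bang\<^sub>0 X) \<otimes> m Y Z) \<Zsemi> m X (Y \<otimes>\<^sub>0 Z)"
    and m_unit_left: "(m\<^sub>I \<otimes> \<one> (bang\<^sub>0 A)) \<Zsemi> m \<I> A = \<one> (bang\<^sub>0 A)"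
    and m_unit_right: "(\<one> (bang\<^sub>0 A) \<otimes> m\<^sub>I) \<Zsemi> m A \<I> = \<one> (bang\<^sub>0 A)"
    and m_symm: "m A B \<Zsemi> bang (\<sigma> A B) = \<sigma> (bang\<^sub>0 A) (bang\<^sub>0 B) \<Zsemi> m B A"
    \<comment> \<open>\<open>\<delta>\<close> and \<open>\<epsilon>\<close> are monoidal transformations\<close>
    and m_delta: "m A B \<Zsemi> \<delta> (A \<otimes>\<^sub>0 B)
        = (\<delta> A \<otimes> \<delta> B) \<Zsemi> m (bang\<^sub>0 A) (bang\<^sub>0 B) \<Zsemi> bang (m A B)"
    and mI_delta: "m\<^sub>I \<Zsemi> \<delta> \<I> = m\<^sub>I \<Zsemi> bang m\<^sub>I"
    and m_eps: "m A B \<Zsemi> \<epsilon> (A \<otimes>\<^sub>0 B) = \<epsilon> A \<otimes> \<epsilon> B"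
    and mI_eps: "m\<^sub>I \<Zsemi> \<epsilon> \<I> = \<one> \<I>"
    \<comment> \<open>\<open>\<Delta>\<close> and \<open>e\<close> are monoidal transformations\<close>
    and m_Delta: "m A B \<Zsemi> \<Delta> (A \<otimes>\<^sub>0 B)
        = (\<Delta> A \<otimes> \<Delta> B) \<Zsemi> (\<one> (bang\<^sub>0 A) \<otimes> \<sigma> (bang\<^sub>0 A) (bang\<^sub>0 B) \<otimes> \<one> (bang\<^sub>0 B))
          \<Zsemi> (m A B \<otimes> m A B)"
    and m_e: "m A B \<Zsemi> e (A \<otimes>\<^sub>0 B) = e A \<otimes> e B"
    and mI_Delta: "m\<^sub>I \<Zsemi> \<Delta> \<I> = m\<^sub>I \<otimes> m\<^sub>I"
    and mI_e: "m\<^sub>I \<Zsemi> e \<I> = \<one> \<I>"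
    \<comment> \<open>\<open>\<Delta>\<close> and \<open>e\<close> are \<open>!\<close>-coalgebra morphisms\<close>
    and delta_bang_Delta: "\<delta> A \<Zsemi> bang (\<Delta> A) = \<Delta> A \<Zsemi> (\<delta> A \<otimes> \<delta> A) \<Zsemi> m (bang\<^sub>0 A) (bang\<^sub>0 A)"
    and delta_bang_e: "\<delta> A \<Zsemi> bang (e A) = e A \<Zsemi> m\<^sub>I"

locale bialgebra_modality =
  coalgebra_modality C bang\<^sub>0 bang \<delta> \<epsilon> \<Delta> e
  for C :: "('o, 'm, 'x) smc_scheme" (structure) and bang\<^sub>0 bang \<delta> \<epsilon> \<Delta> e +
  fixes nabla :: "'o \<Rightarrow> 'm" (\<open>\<nabla>\<close>) and u :: "'o \<Rightarrow> 'm"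
    \<comment> \<open>natural commutative monoids\<close>
  assumes nabla_in_hom: "\<guillemotleft>\<nabla> A : bang\<^sub>0 A \<otimes>\<^sub>0 bang\<^sub>0 A \<rightarrow> bang\<^sub>0 A\<guillemotright>"
    and nabla_natural: "\<guillemotleft>f : X \<rightarrow> Y\<guillemotright> \<Longrightarrow> (bang f \<otimes> bang f) \<Zsemi> \<nabla> Y = \<nabla> X \<Zsemi> bang f"
    and u_in_hom: "\<guillemotleft>u A : \<I> \<rightarrow> bang\<^sub>0 A\<guillemotright>"
    and u_natural: "\<guillemotleft>f : X \<rightarrow> Y\<guillemotright> \<Longrightarrow> u X \<Zsemi> bang f = u Y"
    and nabla_assoc: "(\<nabla> A \<otimes> \<one> (bang\<^sub>0 A)) \<Zsemi> \<nabla> A = (\<one> (bang\<^sub>0 A) \<otimes> \<nabla> A) \<Zsemi> \<nabla> A"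
    and nabla_unit_left: "(u A \<otimes> \<one> (bang\<^sub>0 A)) \<Zsemi> \<nabla> A = \<one> (bang\<^sub>0 A)"
    and nabla_unit_right: "(\<one> (bang\<^sub>0 A) \<otimes> u A) \<Zsemi> \<nabla> A = \<one> (bang\<^sub>0 A)"
    and nabla_comm: "\<sigma> (bang\<^sub>0 A) (bang\<^sub>0 A) \<Zsemi> \<nabla> A = \<nabla> A"
    \<comment> \<open>bimonoid\<close>
    and nabla_Delta: "\<nabla> A \<Zsemi> \<Delta> A
        = (\<Delta> A \<otimes> \<Delta> A) \<Zsemi> (\<one> (bang\<^sub>0 A) \<otimes> \<sigma> (bang\<^sub>0 A) (bang\<^sub>0 A) \<otimes> \<one> (bang\<^sub>0 A))
          \<Zsemi> (\<nabla> A \<otimes> \<nabla> A)"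
    and nabla_e: "\<nabla> A \<Zsemi> e A = e A \<otimes> e A"
    and u_Delta: "u A \<Zsemi> \<Delta> A = u A \<otimes> u A"
    and u_e: "u A \<Zsemi> e A = \<one> \<I>"

locale additive_bialgebra_modality =
  additive_symmetric_monoidal_category C + bialgebra_modality C bang\<^sub>0 bang \<delta> \<epsilon> \<Delta> e nabla u
  for C :: "('o, 'm, 'x) additive_smc_scheme" (structure)
    and bang\<^sub>0 bang \<delta> \<epsilon> \<Delta> e and nabla (\<open>\<nabla>\<close>) and u +
  assumes nabla_eps: "\<nabla> A \<Zsemi> \<epsilon> A = (e A \<otimes> \<epsilon> A) \<oplus> (\<epsilon> A \<otimes> e A)"
    and u_eps: "u A \<Zsemi> \<epsilon> A = \<zero> \<I> A"
    and bang_add: "\<guillemotleft>f : X \<rightarrow> Y\<guillemotright> \<Longrightarrow> \<guillemotleft>g : X \<rightarrow> Y\<guillemotright>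
        \<Longrightarrow> bang (f \<oplus> g) = \<Delta> X \<Zsemi> (bang f \<otimes> bang g) \<Zsemi> \<nabla> Y"
    and bang_zero: "bang (\<zero> X Y) = e X \<Zsemi> u Y"

locale monoidal_bialgebra_modality =
  monoidal_coalgebra_modality C bang\<^sub>0 bang \<delta> \<epsilon> \<Delta> e m m\<^sub>I +
  bialgebra_modality C bang\<^sub>0 bang \<delta> \<epsilon> \<Delta> e nabla u
  for C :: "('o, 'm, 'x) smc_scheme" (structure)
    and bang\<^sub>0 bang \<delta> \<epsilon> \<Delta> e m m\<^sub>I and nabla (\<open>\<nabla>\<close>) and u +
  assumes nabla_m_right: "(\<one> (bang\<^sub>0 A) \<otimes> \<nabla> B) \<Zsemi> m A B
        = (\<Delta> A \<otimes> \<one> (bang\<^sub>0 B) \<otimes> \<one> (bang\<^sub>0 B))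
          \<Zsemi> (\<one> (bang\<^sub>0 A) \<otimes> \<sigma> (bang\<^sub>0 A) (bang\<^sub>0 B) \<otimes> \<one> (bang\<^sub>0 B))
          \<Zsemi> (m A B \<otimes> m A B) \<Zsemi> \<nabla> (A \<otimes>\<^sub>0 B)"
    and nabla_m_left: "(\<nabla> A \<otimes> \<one> (bang\<^sub>0 B)) \<Zsemi> m A B
        = (\<one> (bang\<^sub>0 A) \<otimes> \<one> (bang\<^sub>0 A) \<otimes> \<Delta> B)
          \<Zsemi> (\<one> (bang\<^sub>0 A) \<otimes> \<sigma> (bang\<^sub>0 A) (bang\<^sub>0 B) \<otimes> \<one> (bang\<^sub>0 B))
          \<Zsemi> (m A B \<otimes> m A B) \<Zsemi> \<nabla> (A \<otimes>\<^sub>0 B)"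
    and u_m_left: "(u A \<otimes> \<one> (bang\<^sub>0 B)) \<Zsemi> m A B = e B \<Zsemi> u (A \<otimes>\<^sub>0 B)"
    and u_m_right: "(\<one> (bang\<^sub>0 A) \<otimes> u B) \<Zsemi> m A B = e A \<Zsemi> u (A \<otimes>\<^sub>0 B)"
    and nabla_delta: "\<nabla> A \<Zsemi> \<delta> A = (\<delta> A \<otimes> \<delta> A) \<Zsemi> m (bang\<^sub>0 A) (bang\<^sub>0 A) \<Zsemi> bang (\<nabla> A)"
    and u_delta: "u A \<Zsemi> \<delta> A = m\<^sub>I \<Zsemi> bang (u A)"

text \<open>
  The sets of all modalities of each kind on \<open>C\<close>, with the data grouped as the underlying
  coalgebra modality, the monoidal structure and the bialgebra structure.
\<close>

type_synonym ('o, 'm) coalgebra_data =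
  "('o \<Rightarrow> 'o) \<times> ('m \<Rightarrow> 'm) \<times> ('o \<Rightarrow> 'm) \<times> ('o \<Rightarrow> 'm) \<times> ('o \<Rightarrow> 'm) \<times> ('o \<Rightarrow> 'm)"
type_synonym ('o, 'm) monoidal_data = "('o \<Rightarrow> 'o \<Rightarrow> 'm) \<times> 'm"
type_synonym ('o, 'm) bialgebra_data = "('o \<Rightarrow> 'm) \<times> ('o \<Rightarrow> 'm)"

definition monoidal_coalgebra_modalities ::
    "('o, 'm, 'x) smc_scheme \<Rightarrow> (('o, 'm) coalgebra_data \<times> ('o, 'm) monoidal_data) set"
  where "monoidal_coalgebra_modalities C =
    {((bang\<^sub>0, bang, \<delta>, \<epsilon>, \<Delta>, e), (m, m\<^sub>I)) | bang\<^sub>0 bang \<delta> \<epsilon> \<Delta> e m m\<^sub>I.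
      monoidal_coalgebra_modality C bang\<^sub>0 bang \<delta> \<epsilon> \<Delta> e m m\<^sub>I}"

definition additive_bialgebra_modalities ::
    "('o, 'm, 'x) additive_smc_scheme \<Rightarrow> (('o, 'm) coalgebra_data \<times> ('o, 'm) bialgebra_data) set"
  where "additive_bialgebra_modalities C =
    {((bang\<^sub>0, bang, \<delta>, \<epsilon>, \<Delta>, e), (nabla, u)) | bang\<^sub>0 bang \<delta> \<epsilon> \<Delta> e nabla u.
      additive_bialgebra_modality C bang\<^sub>0 bang \<delta> \<epsilon> \<Delta> e nabla u}"

definition monoidal_bialgebra_modalities ::
    "('o, 'm, 'x) smc_scheme \<Rightarrow>
      (('o, 'm) coalgebra_data \<times> ('o, 'm) monoidal_data \<times> ('o, 'm) bialgebra_data) set"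
  where "monoidal_bialgebra_modalities C =
    {((bang\<^sub>0, bang, \<delta>, \<epsilon>, \<Delta>, e), (m, m\<^sub>I), (nabla, u)) | bang\<^sub>0 bang \<delta> \<epsilon> \<Delta> e m m\<^sub>I nabla u.
      monoidal_bialgebra_modality C bang\<^sub>0 bang \<delta> \<epsilon> \<Delta> e m m\<^sub>I nabla u}"

end

theory Submission
  imports Defs
begin

text \<open>
  Write \<open>\<langle>a, b\<rangle> = \<Delta> Z \<Zsemi> (a \<otimes> b)\<close> for the pairing of two maps out of \<open>!Z\<close>. Think of \<open>!A\<close> as spanned
  by exponentials \<open>exp a\<close>, on which \<open>\<Delta>\<close> and \<open>e\<close> are diagonal. Then every structure in the theorem has
  a forced value on exponentials:
  \<open>m (exp a \<otimes> exp b) = exp (a \<otimes> b)\<close>, \<open>m\<^sub>I = exp 1\<close>, \<open>\<nabla> (exp a \<otimes> exp b) = exp (a + b)\<close>, \<open>u = exp 0\<close>.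
  The proof makes this precise, with coalgebra maps \<open>!Z \<rightarrow> !A\<close> as generalized exponentials. There are
  two ingredients.

  First, \<open>(!A, \<delta> A)\<close> is cofree: a coalgebra map into it is determined by its composite with \<open>\<epsilon> A\<close>
  (\<open>cofree_morphism_ext\<close>). So an equation between coalgebra maps \<open>!Z \<rightarrow> !A\<close> is checked after \<open>\<epsilon> A\<close>,
  where it becomes linear and usually trivial.

  Second, a map out of \<open>!A \<otimes> !B\<close> is determined by its composites with all \<open>\<langle>a, b\<rangle>\<close>, for coalgebra
  maps \<open>a : !Z \<rightarrow> !A\<close> and \<open>b : !Z \<rightarrow> !B\<close> (\<open>pair_separates\<close>). One such pairing,
  \<open>\<langle>!(\<epsilon> \<otimes> e), !(e \<otimes> \<epsilon>)\<rangle> : !(!A \<otimes> !B) \<rightarrow> !A \<otimes> !B\<close>, is already a split epimorphism. In a monoidal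
  coalgebra modality its section is \<open>(\<delta> \<otimes> \<delta>) \<Zsemi> m\<close>; in an additive bialgebra modality it is
  \<open>((\<delta> \<Zsemi> !(1 \<otimes> u)) \<otimes> (\<delta> \<Zsemi> !(u \<otimes> 1))) \<Zsemi> \<nabla>\<close>, which imitates the Seely isomorphism with \<open>!A \<otimes> !B\<close> in the
  place of the missing product \<open>A \<times> B\<close>.

  The locale \<open>pointwise_modality\<close> collects such a section and the requirement that \<open>m\<close>, \<open>m\<^sub>I\<close>, \<open>\<nabla>\<close>, \<open>u\<close>
  send pairings of coalgebra maps to coalgebra maps with the expected composites with \<open>\<epsilon>\<close>. The two
  ingredients show that these four structures satisfy the axioms of all three kinds of modality, and
  that they are uniquely determined by the coalgebra modality (\<open>pointwise_modality_unique\<close>).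
  Conversely, each kind of modality gives a pointwise one: from \<open>m\<close> and \<open>m\<^sub>I\<close> one builds \<open>\<nabla>\<close> and \<open>u\<close>,
  from \<open>\<nabla>\<close> and \<open>u\<close> one builds \<open>m\<close> and \<open>m\<^sub>I\<close>, and in a monoidal bialgebra modality the axioms force
  \<open>\<nabla> \<Zsemi> \<epsilon>\<close> to be the sum of the two projections (proved for \<open>zero_preserving_bialgebra_modality\<close>).
  Hence monoidal bialgebra modalities are exactly the pointwise ones, and forgetting half of the
  structure is bijective in either case.
\<close>

section \<open>Calculating in a symmetric monoidal category\<close>

context symmetric_monoidal_category
begin

text \<open>
  Typing is restated as equations for sources and targets, and the laws are given equational side
  conditions. The simplifier can then compute the type of a composite and apply the laws by itself.
\<close>

lemma source_target_ident [simp]: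
  "source C (\<one> A) = A" "target C (\<one> A) = A"
  using ident_in_hom by (auto simp: in_hom_def)

lemma source_target_symm [simp]:
  "source C (\<sigma> A B) = A \<otimes>\<^sub>0 B" "target C (\<sigma> A B) = B \<otimes>\<^sub>0 A"
  using symm_in_hom by (auto simp: in_hom_def)

lemma source_target_seq [simp]:
  assumes "target C f = source C g"
  shows "source C (f \<Zsemi> g) = source C f" "target C (f \<Zsemi> g) = target C g"
  using seq_in_hom[of f _ _ g] assms by (auto simp: in_hom_def)

lemma source_target_tensor [simp]:
  "source C (f \<otimes> g) = source C f \<otimes>\<^sub>0 source C g" "target C (f \<otimes> g) = target C f \<otimes>\<^sub>0 target C g"
  using tensor_in_hom[of f _ _ g] by (auto simp: in_hom_def)

declare tensor_obj_assoc [simp] tensor_obj_unit_left [simp] tensor_obj_unit_right [simp]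
  tensor_assoc [simp] tensor_unit_left [simp] tensor_unit_right [simp] tensor_ident [simp]

lemma ident_seq [simp]: "source C f = X \<Longrightarrow> \<one> X \<Zsemi> f = f"
  using seq_ident_left by (auto simp: in_hom_def)

lemma seq_ident [simp]: "target C f = X \<Longrightarrow> f \<Zsemi> \<one> X = f"
  using seq_ident_right by (auto simp: in_hom_def)

lemma seq_seq [simp]:
  "target C f = source C g \<Longrightarrow> target C g = source C h \<Longrightarrow> (f \<Zsemi> g) \<Zsemi> h = f
      \<Zsemi> (g \<Zsemi> h)"
  using seq_assoc[of f _ _ g _ h] by (auto simp: in_hom_def)

lemma interchange:
  "target C f = source C h \<Longrightarrow> target C g = source C k
    \<Longrightarrow> (f \<otimes> g) \<Zsemi> (h \<otimes> k) = (f \<Zsemi> h) \<otimes> (g \<Zsemi> k)"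
  using tensor_seq[of f _ _ h _ g _ _ k] by (auto simp: in_hom_def)

lemma interchange_seq:
  assumes "target C f = source C h" "target C g = source C k" "target C h \<otimes>\<^sub>0 target C k = source C l"
  shows "(f \<otimes> g) \<Zsemi> ((h \<otimes> k) \<Zsemi> l) = ((f \<Zsemi> h) \<otimes> (g \<Zsemi> k)) \<Zsemi> l"
proof -
  have "(f \<otimes> g) \<Zsemi> ((h \<otimes> k) \<Zsemi> l) = ((f \<otimes> g) \<Zsemi> (h \<otimes> k)) \<Zsemi> l"
    using assms by simp
  then show ?thesis
    using assms by (simp add: interchange)
qed

text \<open>A map into the unit object commutes past a parallel composite, \<open>I\<close> being a strict unit.\<close>

lemma tensor_scalar_left:
  "target C f = \<I> \<Longrightarrow> target C g = source C h \<Longrightarrow> (f \<otimes> g) \<Zsemi> h = f \<otimes> (g \<Zsemi> h)"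
  using interchange[of f "\<one> \<I>" g h] by simp

lemma tensor_scalar_right:
  "target C g = \<I> \<Longrightarrow> target C f = source C h \<Longrightarrow> (f \<otimes> g) \<Zsemi> h = (f \<Zsemi> h) \<otimes> g"
  using interchange[of f h g "\<one> \<I>"] by simp

lemma symm_natural_eq:
  "target C f = Y \<Longrightarrow> target C g = W
    \<Longrightarrow> (f \<otimes> g) \<Zsemi> \<sigma> Y W = \<sigma> (source C f) (source C g) \<Zsemi> (g \<otimes> f)"
  using symm_natural[of f _ _ g] by (auto simp: in_hom_def)

lemma middle_four_natural:
  assumes "target C f = X" "target C g = Y" "target C h = V" "target C k = W"
  shows "(f \<otimes> g \<otimes> h \<otimes> k) \<Zsemi> (\<one> X \<otimes> \<sigma> Y V \<otimes> \<one> W)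
    = (\<one> (source C f) \<otimes> \<sigma> (source C g) (source C h) \<otimes> \<one> (source C k)) \<Zsemi> (f \<otimes> h \<otimes> g \<otimes> k)"
proof -
  have "(f \<otimes> (g \<otimes> h) \<otimes> k) \<Zsemi> (\<one> X \<otimes> \<sigma> Y V \<otimes> \<one> W)
      = (\<one> (source C f) \<otimes> \<sigma> (source C g) (source C h) \<otimes> \<one> (source C k)) \<Zsemi> (f \<otimes> (h \<otimes> g) \<otimes> k)"
    using assms by (simp add: interchange symm_natural_eq del: tensor_assoc)
  then show ?thesis
    by simp
qed

lemma symm_unit [simp]: "\<sigma> A \<I> = \<one> A" "\<sigma> \<I> A = \<one> A"
proof -
  \<comment> \<open>By the hexagon \<open>\<sigma> A I\<close> is idempotent, and it is invertible.\<close>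
  have "\<sigma> A \<I> = \<sigma> A \<I> \<Zsemi> \<sigma> A \<I>"
    using symm_hexagon[of A \<I> \<I>] by simp
  then have "\<sigma> \<I> A \<Zsemi> \<sigma> A \<I> = \<sigma> \<I> A \<Zsemi> (\<sigma> A \<I> \<Zsemi> \<sigma> A \<I>)"
    by simp
  then have "\<sigma> \<I> A \<Zsemi> \<sigma> A \<I> = (\<sigma> \<I> A \<Zsemi> \<sigma> A \<I>) \<Zsemi> \<sigma> A \<I>"
    by (subst seq_seq) simp_all
  then show 1: "\<sigma> A \<I> = \<one> A"
    by (simp only: symm_involutive) simp
  show "\<sigma> \<I> A = \<one> A"
    using symm_involutive[of \<I> A] 1 by simp
qed

end

context additive_symmetric_monoidal_category
begin

lemma source_target_zero [simp]: "source C (\<zero> X Y) = X" "target C (\<zero> X Y) = Y"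
  using zero_in_hom by (auto simp: in_hom_def)

lemma source_target_add [simp]:
  assumes "source C f = source C g" "target C f = target C g"
  shows "source C (f \<oplus> g) = source C f" "target C (f \<oplus> g) = target C f"
  using add_in_hom[of f _ _ g] assms by (auto simp: in_hom_def)

lemma seq_add_eq:
  "target C f = source C g \<Longrightarrow> source C g = source C h \<Longrightarrow> target C g = target C h
    \<Longrightarrow> f \<Zsemi> (g \<oplus> h) = (f \<Zsemi> g) \<oplus> (f \<Zsemi> h)"
  using seq_add[of f _ _ g _ h] by (auto simp: in_hom_def)

lemma add_seq_eq:
  "source C g = source C h \<Longrightarrow> target C g = target C h \<Longrightarrow> target C h = source C k
    \<Longrightarrow> (g \<oplus> h) \<Zsemi> k = (g \<Zsemi> k) \<oplus> (h \<Zsemi> k)"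
  using add_seq[of g _ _ h k] by (auto simp: in_hom_def)

lemma tensor_add_eq:
  "source C g = source C h \<Longrightarrow> target C g = target C h \<Longrightarrow> f \<otimes> (g \<oplus> h) = (f \<otimes> g) \<oplus> (f \<otimes> h)"
  using tensor_add[of f _ _ g _ _ h] by (auto simp: in_hom_def)

lemma add_tensor_eq:
  "source C g = source C h \<Longrightarrow> target C g = target C h \<Longrightarrow> (g \<oplus> h) \<otimes> f = (g \<otimes> f) \<oplus> (h \<otimes> f)"
  using add_tensor[of g _ _ h f] by (auto simp: in_hom_def)

lemma seq_zero_eq [simp]: "target C f = Y \<Longrightarrow> f \<Zsemi> \<zero> Y Z = \<zero> (source C f) Z"
  using seq_zero by (auto simp: in_hom_def)

lemma zero_seq_eq [simp]: "source C f = Y \<Longrightarrow> \<zero> X Y \<Zsemi> f = \<zero> X (target C f)"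
  using zero_seq by (auto simp: in_hom_def)

lemma tensor_zero_eq [simp]:
  "f \<otimes> \<zero> Z W = \<zero> (source C f \<otimes>\<^sub>0 Z) (target C f \<otimes>\<^sub>0 W)"
  using tensor_zero by (auto simp: in_hom_def)

lemma zero_tensor_eq [simp]:
  "\<zero> Z W \<otimes> f = \<zero> (Z \<otimes>\<^sub>0 source C f) (W \<otimes>\<^sub>0 target C f)"
  using zero_tensor by (auto simp: in_hom_def)

lemma add_zero_eq [simp]: "source C f = X \<Longrightarrow> target C f = Y \<Longrightarrow> f \<oplus> \<zero> X Y = f"
  using add_zero by (auto simp: in_hom_def)

lemma add_commute_eq:
  "source C f = source C g \<Longrightarrow> target C f = target C g \<Longrightarrow> f \<oplus> g = g \<oplus> f"
  using add_commute by (auto simp: in_hom_def)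

lemma zero_add_eq [simp]: "source C f = X \<Longrightarrow> target C f = Y \<Longrightarrow> \<zero> X Y \<oplus> f = f"
  using add_commute_eq[of "\<zero> X Y" f] by simp

lemma add_assoc_eq:
  "source C f = source C g \<Longrightarrow> target C f = target C g \<Longrightarrow> source C g = source C h
    \<Longrightarrow> target C g = target C h \<Longrightarrow> (f \<oplus> g) \<oplus> h = f \<oplus> (g \<oplus> h)"
  using add_assoc[of f _ _ g h] by (auto simp: in_hom_def)

end

section \<open>Morphisms between cofree coalgebras and their pairing\<close>

context coalgebra_modality
begin

lemma source_target_bang [simp]:
  "source C (bang f) = bang\<^sub>0 (source C f)" "target C (bang f) = bang\<^sub>0 (target C f)"
  using bang_in_hom[of f] by (auto simp: in_hom_def)

lemma source_target_structure [simp]: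
  "source C (\<delta> A) = bang\<^sub>0 A" "target C (\<delta> A) = bang\<^sub>0 (bang\<^sub>0 A)"
  "source C (\<epsilon> A) = bang\<^sub>0 A" "target C (\<epsilon> A) = A"
  "source C (\<Delta> A) = bang\<^sub>0 A" "target C (\<Delta> A) = bang\<^sub>0 A \<otimes>\<^sub>0 bang\<^sub>0 A"
  "source C (e A) = bang\<^sub>0 A" "target C (e A) = \<I>"
  using delta_in_hom eps_in_hom Delta_in_hom e_in_hom by (auto simp: in_hom_def)

declare bang_ident [simp]

lemma bang_seq_eq: "target C f = source C g \<Longrightarrow> bang (f \<Zsemi> g) = bang f \<Zsemi> bang g"
  using bang_seq[of f _ _ g] by (auto simp: in_hom_def)

lemma bang_delta: "target C f = Y \<Longrightarrow> bang f \<Zsemi> \<delta> Y = \<delta> (source C f) \<Zsemi> bang (bang f)"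
  using delta_natural by (auto simp: in_hom_def)

lemma bang_eps [simp]: "target C f = Y \<Longrightarrow> bang f \<Zsemi> \<epsilon> Y = \<epsilon> (source C f) \<Zsemi> f"
  using eps_natural by (auto simp: in_hom_def)

lemma bang_Delta:
  "target C f = Y \<Longrightarrow> bang f \<Zsemi> \<Delta> Y = \<Delta> (source C f) \<Zsemi> (bang f \<otimes> bang f)"
  using Delta_natural by (auto simp: in_hom_def)

lemma bang_e [simp]: "target C f = Y \<Longrightarrow> bang f \<Zsemi> e Y = e (source C f)"
  using e_natural by (auto simp: in_hom_def)

declare delta_eps [simp] delta_bang_eps [simp] delta_e [simp]

lemma delta_eps_seq [simp]:
  assumes "source C f = bang\<^sub>0 A"
  shows "\<delta> A \<Zsemi> (\<epsilon> (bang\<^sub>0 A) \<Zsemi> f) = f"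
proof -
  have "\<delta> A \<Zsemi> (\<epsilon> (bang\<^sub>0 A) \<Zsemi> f) = (\<delta> A \<Zsemi> \<epsilon> (bang\<^sub>0 A)) \<Zsemi> f"
    using assms by (subst seq_seq) simp_all
  then show ?thesis
    using assms by simp
qed

definition cofree_morphism
  where "cofree_morphism Z A a \<longleftrightarrow>
    \<guillemotleft>a : bang\<^sub>0 Z \<rightarrow> bang\<^sub>0 A\<guillemotright> \<and> a \<Zsemi> \<delta> A = \<delta> Z \<Zsemi> bang a"

lemma cofree_morphismI:
  "source C a = bang\<^sub>0 Z \<Longrightarrow> target C a = bang\<^sub>0 A \<Longrightarrow> a \<Zsemi> \<delta> A = \<delta> Z \<Zsemi> bang a
    \<Longrightarrow> cofree_morphism Z A a"
  by (simp add: cofree_morphism_def in_hom_def)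

lemma cofree_morphism_source_target [simp]:
  assumes "cofree_morphism Z A a"
  shows "source C a = bang\<^sub>0 Z" "target C a = bang\<^sub>0 A"
  using assms unfolding cofree_morphism_def in_hom_def by blast+

lemma cofree_morphism_seq_delta:
  "cofree_morphism Z A a \<Longrightarrow> a \<Zsemi> \<delta> A = \<delta> Z \<Zsemi> bang a"
  unfolding cofree_morphism_def by blast

lemma cofree_morphism_bang:
  "source C f = Z \<Longrightarrow> target C f = A \<Longrightarrow> cofree_morphism Z A (bang f)"
  by (rule cofree_morphismI) (simp_all add: bang_delta)

lemma cofree_morphism_ident: "cofree_morphism A A (\<one> (bang\<^sub>0 A))"
  using cofree_morphism_bang[of "\<one> A" A A] by simp

lemma cofree_morphism_delta: "cofree_morphism A (bang\<^sub>0 A) (\<delta> A)"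
  by (rule cofree_morphismI) (simp_all add: delta_delta)

lemma cofree_morphism_seq:
  assumes a: "cofree_morphism Z A a" and b: "cofree_morphism A B b"
  shows "cofree_morphism Z B (a \<Zsemi> b)"
proof (rule cofree_morphismI)
  have "(a \<Zsemi> b) \<Zsemi> \<delta> B = a \<Zsemi> (\<delta> A \<Zsemi> bang b)"
    using a b by (simp add: cofree_morphism_seq_delta)
  also have "\<dots> = (a \<Zsemi> \<delta> A) \<Zsemi> bang b"
    using a b by simp
  also have "\<dots> = (\<delta> Z \<Zsemi> bang a) \<Zsemi> bang b"
    using a by (simp only: cofree_morphism_seq_delta)
  also have "\<dots> = \<delta> Z \<Zsemi> bang (a \<Zsemi> b)"
    using a b by (simp add: bang_seq_eq)
  finally show "(a \<Zsemi> b) \<Zsemi> \<delta> B = \<delta> Z \<Zsemi> bang (a \<Zsemi> b)" .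
qed (use a b in simp_all)

text \<open>
  The universal property of the cofree coalgebra \<open>!A\<close>: coalgebra maps into it are determined by
  their composites with the counit.
\<close>

lemma cofree_morphism_eq_delta_bang:
  assumes a: "cofree_morphism Z A a"
  shows "a = \<delta> Z \<Zsemi> bang (a \<Zsemi> \<epsilon> A)"
proof -
  have "a = a \<Zsemi> (\<delta> A \<Zsemi> bang (\<epsilon> A))"
    using a by simp
  also have "\<dots> = (a \<Zsemi> \<delta> A) \<Zsemi> bang (\<epsilon> A)"
    using a by (subst seq_seq) simp_all
  also have "\<dots> = (\<delta> Z \<Zsemi> bang a) \<Zsemi> bang (\<epsilon> A)"
    using a by (simp only: cofree_morphism_seq_delta)
  also have "\<dots> = \<delta> Z \<Zsemi> bang (a \<Zsemi> \<epsilon> A)"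
    using a by (simp add: bang_seq_eq)
  finally show ?thesis .
qed

lemma cofree_morphism_ext:
  assumes "cofree_morphism Z A a" "cofree_morphism Z A b" "a \<Zsemi> \<epsilon> A = b \<Zsemi> \<epsilon> A"
  shows "a = b"
  by (subst cofree_morphism_eq_delta_bang[OF assms(1)], subst cofree_morphism_eq_delta_bang[OF assms(2)])
    (simp only: assms(3))

lemma cofree_morphism_delta_bang:
  "source C f = bang\<^sub>0 Z \<Longrightarrow> target C f = A \<Longrightarrow> cofree_morphism Z A (\<delta> Z \<Zsemi> bang f)"
  by (rule cofree_morphism_seq[OF cofree_morphism_delta cofree_morphism_bang])

definition pair
  where "pair Z f g = \<Delta> Z \<Zsemi> (f \<otimes> g)"

lemma source_target_pair [simp]:
  assumes "source C f = bang\<^sub>0 Z" "source C g = bang\<^sub>0 Z"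
  shows "source C (pair Z f g) = bang\<^sub>0 Z" "target C (pair Z f g) = target C f \<otimes>\<^sub>0 target C g"
  using assms by (simp_all add: pair_def)

lemma pair_tensor [simp]:
  assumes "source C f = bang\<^sub>0 Z" "source C g = bang\<^sub>0 Z"
    and "target C f = source C h" "target C g = source C k"
  shows "pair Z f g \<Zsemi> (h \<otimes> k) = pair Z (f \<Zsemi> h) (g \<Zsemi> k)"
  using assms by (simp add: pair_def interchange)

lemma pair_tensor_seq [simp]:
  assumes "source C f = bang\<^sub>0 Z" "source C g = bang\<^sub>0 Z"
    and "target C f = source C h" "target C g = source C k"
    and "target C h \<otimes>\<^sub>0 target C k = source C l"
  shows "pair Z f g \<Zsemi> ((h \<otimes> k) \<Zsemi> l) = pair Z (f \<Zsemi> h) (g \<Zsemi> k) \<Zsemi> l"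
  using assms by (simp add: pair_def interchange_seq)

text \<open>
  A coalgebra map \<open>!Z \<rightarrow> !A\<close> is \<open>\<delta> Z\<close> followed by some \<open>!f\<close>, and both of these preserve \<open>\<Delta>\<close> and \<open>e\<close>.
\<close>

lemma cofree_morphism_Delta:
  assumes a: "cofree_morphism Z A a"
  shows "a \<Zsemi> \<Delta> A = pair Z a a"
proof -
  define f where "f = a \<Zsemi> \<epsilon> A"
  have f: "source C f = bang\<^sub>0 Z" "target C f = A"
    using a by (simp_all add: f_def)
  have af: "a = \<delta> Z \<Zsemi> bang f"
    unfolding f_def by (rule cofree_morphism_eq_delta_bang[OF a])
  have "a \<Zsemi> \<Delta> A = \<delta> Z \<Zsemi> (\<Delta> (bang\<^sub>0 Z) \<Zsemi> (bang f \<otimes> bang f))"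
    unfolding af using f by (simp add: bang_Delta)
  also have "\<dots> = (\<delta> Z \<Zsemi> \<Delta> (bang\<^sub>0 Z)) \<Zsemi> (bang f \<otimes> bang f)"
    using f by (subst seq_seq) simp_all
  also have "\<dots> = pair Z a a"
    unfolding af pair_def delta_Delta using f by (simp add: interchange)
  finally show ?thesis .
qed

lemma cofree_morphism_e [simp]:
  assumes a: "cofree_morphism Z A a"
  shows "a \<Zsemi> e A = e Z"
proof -
  define f where "f = a \<Zsemi> \<epsilon> A"
  have f: "source C f = bang\<^sub>0 Z" "target C f = A"
    using a by (simp_all add: f_def)
  have "a = \<delta> Z \<Zsemi> bang f"
    unfolding f_def by (rule cofree_morphism_eq_delta_bang[OF a])
  then show ?thesis
    using f by simp
qed

lemma cofree_morphism_pair [simp]: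
  assumes a: "cofree_morphism Z A a" and fg: "source C f = bang\<^sub>0 A" "source C g = bang\<^sub>0 A"
  shows "a \<Zsemi> pair A f g = pair Z (a \<Zsemi> f) (a \<Zsemi> g)"
proof -
  have "a \<Zsemi> pair A f g = (a \<Zsemi> \<Delta> A) \<Zsemi> (f \<otimes> g)"
    unfolding pair_def using a fg by simp
  then show ?thesis
    using a fg by (simp add: cofree_morphism_Delta)
qed

lemma pair_assoc:
  assumes "source C f = bang\<^sub>0 Z" "source C g = bang\<^sub>0 Z" "source C h = bang\<^sub>0 Z"
  shows "pair Z (pair Z f g) h = pair Z f (pair Z g h)"
proof -
  have "pair Z (pair Z f g) h = \<Delta> Z \<Zsemi> ((\<Delta> Z \<otimes> \<one> (bang\<^sub>0 Z)) \<Zsemi> ((f \<otimes> g) \<otimes> h))"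
    unfolding pair_def using assms by (subst interchange) simp_all
  also have "\<dots> = (\<Delta> Z \<Zsemi> (\<Delta> Z \<otimes> \<one> (bang\<^sub>0 Z))) \<Zsemi> ((f \<otimes> g) \<otimes> h)"
    using assms by (subst seq_seq) simp_all
  also have "\<dots> = \<Delta> Z \<Zsemi> ((\<one> (bang\<^sub>0 Z) \<otimes> \<Delta> Z) \<Zsemi> (f \<otimes> (g \<otimes> h)))"
    unfolding Delta_coassoc using assms by (subst seq_seq) simp_all
  also have "\<dots> = pair Z f (pair Z g h)"
    unfolding pair_def using assms by (subst interchange) simp_all
  finally show ?thesis .
qed

lemma pair_symm:
  assumes "source C f = bang\<^sub>0 Z" "source C g = bang\<^sub>0 Z" "target C f = X" "target C g = Y"
  shows "pair Z f g \<Zsemi> \<sigma> X Y = pair Z g f"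
proof -
  have "pair Z f g \<Zsemi> \<sigma> X Y = (\<Delta> Z \<Zsemi> \<sigma> (bang\<^sub>0 Z) (bang\<^sub>0 Z)) \<Zsemi> (g \<otimes> f)"
    unfolding pair_def using assms by (simp add: symm_natural_eq)
  then show ?thesis
    by (simp add: Delta_cocomm pair_def)
qed

lemma pair_symm_seq:
  assumes "source C f = bang\<^sub>0 Z" "source C g = bang\<^sub>0 Z" "target C f = X" "target C g = Y"
    and "source C h = Y \<otimes>\<^sub>0 X"
  shows "pair Z f g \<Zsemi> (\<sigma> X Y \<Zsemi> h) = pair Z g f \<Zsemi> h"
  using assms by (simp add: seq_seq[symmetric] pair_symm del: seq_seq)

lemma pair_e [simp]:
  assumes "source C f = bang\<^sub>0 Z"
  shows "pair Z (e Z) f = f" "pair Z f (e Z) = f"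
proof -
  have "pair Z (e Z) f = (\<Delta> Z \<Zsemi> (e Z \<otimes> \<one> (bang\<^sub>0 Z))) \<Zsemi> f"
    unfolding pair_def using assms by (simp add: tensor_scalar_left)
  then show "pair Z (e Z) f = f"
    using assms by (simp add: Delta_counit_left)
  have "pair Z f (e Z) = (\<Delta> Z \<Zsemi> (\<one> (bang\<^sub>0 Z) \<otimes> e Z)) \<Zsemi> f"
    unfolding pair_def using assms by (simp add: tensor_scalar_right)
  then show "pair Z f (e Z) = f"
    using assms by (simp add: Delta_counit_right)
qed

lemma pair_e_seq:
  assumes "source C f = bang\<^sub>0 Z" "source C x = \<I>"
  shows "pair Z (e Z \<Zsemi> x) f = f \<Zsemi> (x \<otimes> \<one> (target C f))"
    "pair Z f (e Z \<Zsemi> x) = f \<Zsemi> (\<one> (target C f) \<otimes> x)"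
proof -
  have "pair Z (e Z) f \<Zsemi> (x \<otimes> \<one> (target C f)) = pair Z (e Z \<Zsemi> x) f"
    using assms by (subst pair_tensor) simp_all
  then show "pair Z (e Z \<Zsemi> x) f = f \<Zsemi> (x \<otimes> \<one> (target C f))"
    using assms by simp
  have "pair Z f (e Z) \<Zsemi> (\<one> (target C f) \<otimes> x) = pair Z f (e Z \<Zsemi> x)"
    using assms by (subst pair_tensor) simp_all
  then show "pair Z f (e Z \<Zsemi> x) = f \<Zsemi> (\<one> (target C f) \<otimes> x)"
    using assms by simp
qed

lemma pair_e_e:
  assumes "source C x = \<I>" "source C y = \<I>"
  shows "pair Z (e Z \<Zsemi> x) (e Z \<Zsemi> y) = e Z \<Zsemi> (x \<otimes> y)"
proof -
  have "pair Z (e Z) (e Z) \<Zsemi> (x \<otimes> y) = pair Z (e Z \<Zsemi> x) (e Z \<Zsemi> y)"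
    using assms by (subst pair_tensor) simp_all
  then show ?thesis
    by simp
qed

lemma pair_ident [simp]: "pair Z (\<one> (bang\<^sub>0 Z)) (\<one> (bang\<^sub>0 Z)) = \<Delta> Z"
  by (simp add: pair_def)

text \<open>
  The middle interchange is absorbed by pairings because \<open>\<Delta>\<close> is coassociative and cocommutative:
  only the two inner components are exchanged.
\<close>

lemma pair_middle_four:
  assumes src: "source C f = bang\<^sub>0 Z" "source C g = bang\<^sub>0 Z" "source C h = bang\<^sub>0 Z"
      "source C k = bang\<^sub>0 Z"
    and tgt: "target C f = X" "target C g = Y" "target C h = V" "target C k = W"
  shows "pair Z (pair Z f g) (pair Z h k) \<Zsemi> (\<one> X \<otimes> \<sigma> Y V \<otimes> \<one> W)
    = pair Z (pair Z f h) (pair Z g k)"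
proof -
  have "pair Z (pair Z f g) (pair Z h k) = pair Z f (pair Z (pair Z g h) k)"
    using src by (simp add: pair_assoc)
  then show ?thesis
    using src tgt by (simp add: pair_symm) (simp add: pair_assoc)
qed

lemma pair_middle_four_seq:
  assumes src: "source C f = bang\<^sub>0 Z" "source C g = bang\<^sub>0 Z" "source C h = bang\<^sub>0 Z"
      "source C k = bang\<^sub>0 Z"
    and tgt: "target C f = X" "target C g = Y" "target C h = V" "target C k = W"
    and l: "source C l = X \<otimes>\<^sub>0 V \<otimes>\<^sub>0 Y \<otimes>\<^sub>0 W"
  shows "pair Z (pair Z f g) (pair Z h k) \<Zsemi> ((\<one> X \<otimes> \<sigma> Y V \<otimes> \<one> W) \<Zsemi> l)
    = pair Z (pair Z f h) (pair Z g k) \<Zsemi> l"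
proof -
  have "pair Z (pair Z f g) (pair Z h k) \<Zsemi> ((\<one> X \<otimes> \<sigma> Y V \<otimes> \<one> W) \<Zsemi> l)
      = (pair Z (pair Z f g) (pair Z h k) \<Zsemi> (\<one> X \<otimes> \<sigma> Y V \<otimes> \<one> W)) \<Zsemi> l"
    using assms by (subst seq_seq) simp_all
  then show ?thesis
    by (simp only: pair_middle_four[OF src tgt])
qed

text \<open>
  Here \<open>!A \<otimes> !B\<close> carries the tensor product of the comonoids \<open>!A\<close> and \<open>!B\<close>.
\<close>

definition comonoid_morphism
  where "comonoid_morphism A B W t \<longleftrightarrow>
    \<guillemotleft>t : bang\<^sub>0 A \<otimes>\<^sub>0 bang\<^sub>0 B \<rightarrow> bang\<^sub>0 W\<guillemotright> \<and>
    t \<Zsemi> \<Delta> W = (\<Delta> A \<otimes> \<Delta> B) \<Zsemi> (\<one> (bang\<^sub>0 A) \<otimes> \<sigma> (bang\<^sub>0 A) (bang\<^sub>0 B) \<otimes> \<one> (bang\<^sub>0 B)) \<Zsemi> (t \<otimes> t)"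

lemma comonoid_morphism_precompose:
  assumes a: "cofree_morphism A A' a" and b: "cofree_morphism B B' b"
    and t: "comonoid_morphism A' B' W t"
  shows "comonoid_morphism A B W ((a \<otimes> b) \<Zsemi> t)"
proof -
  have t_st: "source C t = bang\<^sub>0 A' \<otimes>\<^sub>0 bang\<^sub>0 B'" "target C t = bang\<^sub>0 W"
    using t by (simp_all add: comonoid_morphism_def in_hom_def)
  have "((a \<otimes> b) \<Zsemi> t) \<Zsemi> \<Delta> W = (a \<otimes> b) \<Zsemi> (t \<Zsemi> \<Delta> W)"
    using a b t_st by simp
  also have "t \<Zsemi> \<Delta> W = (\<Delta> A' \<otimes> \<Delta> B')
      \<Zsemi> ((\<one> (bang\<^sub>0 A') \<otimes> \<sigma> (bang\<^sub>0 A') (bang\<^sub>0 B') \<otimes> \<one> (bang\<^sub>0 B')) \<Zsemi> (t \<otimes> t))"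
    using t t_st by (simp add: comonoid_morphism_def)
  also have "(a \<otimes> b) \<Zsemi> \<dots> = (\<Delta> A \<otimes> \<Delta> B) \<Zsemi> ((a \<otimes> a \<otimes> b \<otimes> b)
      \<Zsemi> ((\<one> (bang\<^sub>0 A') \<otimes> \<sigma> (bang\<^sub>0 A') (bang\<^sub>0 B') \<otimes> \<one> (bang\<^sub>0 B')) \<Zsemi> (t \<otimes> t)))"
  proof -
    have "(a \<otimes> b) \<Zsemi> (\<Delta> A' \<otimes> \<Delta> B') = (\<Delta> A \<otimes> \<Delta> B) \<Zsemi> ((a \<otimes> a) \<otimes> (b \<otimes> b))"
      using a b by (simp add: interchange cofree_morphism_Delta pair_def del: tensor_assoc)
    then show ?thesis
      using a b t_st by (simp add: seq_seq[symmetric] del: seq_seq)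
  qed
  also have "(a \<otimes> a \<otimes> b \<otimes> b)
      \<Zsemi> ((\<one> (bang\<^sub>0 A') \<otimes> \<sigma> (bang\<^sub>0 A') (bang\<^sub>0 B') \<otimes> \<one> (bang\<^sub>0 B')) \<Zsemi> (t \<otimes> t))
    = (\<one> (bang\<^sub>0 A) \<otimes> \<sigma> (bang\<^sub>0 A) (bang\<^sub>0 B) \<otimes> \<one> (bang\<^sub>0 B)) \<Zsemi> ((a \<otimes> b \<otimes> a \<otimes> b) \<Zsemi> (t \<otimes> t))"
  proof -
    have "(a \<otimes> a \<otimes> b \<otimes> b) \<Zsemi> (\<one> (bang\<^sub>0 A') \<otimes> \<sigma> (bang\<^sub>0 A') (bang\<^sub>0 B') \<otimes> \<one> (bang\<^sub>0 B'))
      = (\<one> (bang\<^sub>0 A) \<otimes> \<sigma> (bang\<^sub>0 A) (bang\<^sub>0 B) \<otimes> \<one> (bang\<^sub>0 B)) \<Zsemi> (a \<otimes> b \<otimes> a \<otimes> b)"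
      using a b by (subst middle_four_natural) simp_all
    then show ?thesis
      using a b t_st by (simp add: seq_seq[symmetric] del: seq_seq)
  qed
  also have "(a \<otimes> b \<otimes> a \<otimes> b) \<Zsemi> (t \<otimes> t) = ((a \<otimes> b) \<Zsemi> t) \<otimes> ((a \<otimes> b) \<Zsemi> t)"
    using a b t_st interchange[of "a \<otimes> b" t "a \<otimes> b" t] by simp
  finally show ?thesis
    using a b t_st by (simp add: comonoid_morphism_def in_hom_def)
qed

text \<open>
  For elements, \<open>s\<close> sends \<open>x \<otimes> y\<close> to something whose two coordinates are \<open>x\<close> and \<open>y\<close>. Since \<open>s\<close>
  commutes with comultiplication, \<open>!p\<close> and \<open>!q\<close> act on separate copies of the input, and the counits
  remove what each of them discards.
\<close>

lemma comonoid_morphism_seq_pair: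
  assumes s: "comonoid_morphism A B W s"
    and pq: "source C p = W" "target C p = A" "source C q = W" "target C q = B"
    and sp: "s \<Zsemi> bang p = \<one> (bang\<^sub>0 A) \<otimes> e B" and sq: "s \<Zsemi> bang q = e A \<otimes> \<one> (bang\<^sub>0 B)"
  shows "s \<Zsemi> pair W (bang p) (bang q) = \<one> (bang\<^sub>0 A \<otimes>\<^sub>0 bang\<^sub>0 B)"
proof -
  let ?twist = "\<one> (bang\<^sub>0 A) \<otimes> \<sigma> (bang\<^sub>0 A) (bang\<^sub>0 B) \<otimes> \<one> (bang\<^sub>0 B)"
  have s_st: "source C s = bang\<^sub>0 A \<otimes>\<^sub>0 bang\<^sub>0 B" "target C s = bang\<^sub>0 W"
    using s by (simp_all add: comonoid_morphism_def in_hom_def)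
  have "s \<Zsemi> pair W (bang p) (bang q) = (s \<Zsemi> \<Delta> W) \<Zsemi> (bang p \<otimes> bang q)"
    using s_st pq by (simp add: pair_def)
  also have "\<dots> = (\<Delta> A \<otimes> \<Delta> B) \<Zsemi> (?twist \<Zsemi> ((s \<otimes> s) \<Zsemi> (bang p \<otimes> bang q)))"
    using s s_st pq by (simp add: comonoid_morphism_def)
  also have "(s \<otimes> s) \<Zsemi> (bang p \<otimes> bang q) = \<one> (bang\<^sub>0 A) \<otimes> (e B \<otimes> e A) \<otimes> \<one> (bang\<^sub>0 B)"
    using s_st pq by (simp add: interchange sp sq)
  also have "?twist \<Zsemi> \<dots> = \<one> (bang\<^sub>0 A) \<otimes> (e A \<otimes> e B) \<otimes> \<one> (bang\<^sub>0 B)"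
    using symm_natural_eq[of "e A" \<I> "e B" \<I>] by (simp add: interchange del: tensor_assoc)
  also have "(\<Delta> A \<otimes> \<Delta> B) \<Zsemi> \<dots>
      = (\<Delta> A \<Zsemi> (\<one> (bang\<^sub>0 A) \<otimes> e A)) \<otimes> (\<Delta> B \<Zsemi> (e B \<otimes> \<one> (bang\<^sub>0 B)))"
    using interchange[of "\<Delta> A" "\<one> (bang\<^sub>0 A) \<otimes> e A" "\<Delta> B" "e B \<otimes> \<one> (bang\<^sub>0 B)"] by simp
  also have "\<dots> = \<one> (bang\<^sub>0 A \<otimes>\<^sub>0 bang\<^sub>0 B)"
    by (simp add: Delta_counit_left Delta_counit_right)
  finally show ?thesis .
qed

end

section \<open>Modalities with enough cofree points\<close>

text \<open>
  Structure maps with the values on exponentials described at the beginning. The axioms on \<open>Z\<close>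
  say that generalized exponentials are sent to generalized exponentials, the axioms on \<open>\<epsilon>\<close> say to
  which ones, and the last two axioms say that there are enough of them.
\<close>

locale pointwise_modality =
  additive_symmetric_monoidal_category C + coalgebra_modality C bang\<^sub>0 bang \<delta> \<epsilon> \<Delta> e
  for C :: "('o, 'm, 'x) additive_smc_scheme" (structure)
    and bang\<^sub>0 bang \<delta> \<epsilon> \<Delta> e +
  fixes m :: "'o \<Rightarrow> 'o \<Rightarrow> 'm" and m\<^sub>I :: 'm and nabla :: "'o \<Rightarrow> 'm" (\<open>\<nabla>\<close>) and u :: "'o \<Rightarrow> 'm"
  assumes source_target_m [simp]:
      "source C (m A B) = bang\<^sub>0 A \<otimes>\<^sub>0 bang\<^sub>0 B" "target C (m A B) = bang\<^sub>0 (A \<otimes>\<^sub>0 B)"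
    and source_target_mI [simp]: "source C m\<^sub>I = \<I>" "target C m\<^sub>I = bang\<^sub>0 \<I>"
    and source_target_nabla [simp]:
      "source C (\<nabla> A) = bang\<^sub>0 A \<otimes>\<^sub>0 bang\<^sub>0 A" "target C (\<nabla> A) = bang\<^sub>0 A"
    and source_target_u [simp]: "source C (u A) = \<I>" "target C (u A) = bang\<^sub>0 A"
    and cofree_morphism_m: "cofree_morphism Z A a \<Longrightarrow> cofree_morphism Z B b
      \<Longrightarrow> cofree_morphism Z (A \<otimes>\<^sub>0 B) (pair Z a b \<Zsemi> m A B)"
    and cofree_morphism_mI: "cofree_morphism Z \<I> (e Z \<Zsemi> m\<^sub>I)"
    and cofree_morphism_nabla: "cofree_morphism Z A a \<Longrightarrow> cofree_morphism Z A b
      \<Longrightarrow> cofree_morphism Z A (pair Z a b \<Zsemi> \<nabla> A)"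
    and cofree_morphism_u: "cofree_morphism Z A (e Z \<Zsemi> u A)"
    and m_seq_eps [simp]: "m A B \<Zsemi> \<epsilon> (A \<otimes>\<^sub>0 B) = \<epsilon> A \<otimes> \<epsilon> B"
    and mI_seq_eps [simp]: "m\<^sub>I \<Zsemi> \<epsilon> \<I> = \<one> \<I>"
    and nabla_seq_eps [simp]: "\<nabla> A \<Zsemi> \<epsilon> A = (e A \<otimes> \<epsilon> A) \<oplus> (\<epsilon> A \<otimes> e A)"
    and u_seq_eps [simp]: "u A \<Zsemi> \<epsilon> A = \<zero> \<I> A"
    and bang_pair_section: "\<exists>s. \<guillemotleft>s : bang\<^sub>0 A \<otimes>\<^sub>0 bang\<^sub>0 B \<rightarrow> bang\<^sub>0 (bang\<^sub>0 A \<otimes>\<^sub>0 bang\<^sub>0 B)\<guillemotright>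
      \<and> s \<Zsemi> pair (bang\<^sub>0 A \<otimes>\<^sub>0 bang\<^sub>0 B) (bang (\<epsilon> A \<otimes> e B)) (bang (e A \<otimes> \<epsilon> B))
        = \<one> (bang\<^sub>0 A \<otimes>\<^sub>0 bang\<^sub>0 B)"
    and e_section: "\<exists>s. \<guillemotleft>s : \<I> \<rightarrow> bang\<^sub>0 \<I>\<guillemotright> \<and> s \<Zsemi> e \<I> = \<one> \<I>"
begin

lemma e_separates:
  assumes "source C f = \<I>" "source C g = \<I>" "e \<I> \<Zsemi> f = e \<I> \<Zsemi> g"
  shows "f = g"
proof -
  obtain s where s: "source C s = \<I>" "target C s = bang\<^sub>0 \<I>" "s \<Zsemi> e \<I> = \<one> \<I>"
    using e_section by (auto simp: in_hom_def)
  have "(s \<Zsemi> e \<I>) \<Zsemi> f = (s \<Zsemi> e \<I>) \<Zsemi> g"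
    using assms s(1,2) by simp
  then show ?thesis
    using assms by (simp add: s(3))
qed

text \<open>
  The pairing that has a section is itself a pairing of coalgebra maps, so testing on it is enough.
\<close>

lemma pair_separates:
  assumes fg: "source C f = bang\<^sub>0 A \<otimes>\<^sub>0 bang\<^sub>0 B" "source C g = bang\<^sub>0 A \<otimes>\<^sub>0 bang\<^sub>0 B"
    and eq: "\<And>Z a b. cofree_morphism Z A a \<Longrightarrow> cofree_morphism Z B b
      \<Longrightarrow> pair Z a b \<Zsemi> f = pair Z a b \<Zsemi> g"
  shows "f = g"
proof -
  define r where
    "r = pair (bang\<^sub>0 A \<otimes>\<^sub>0 bang\<^sub>0 B) (bang (\<epsilon> A \<otimes> e B)) (bang (e A \<otimes> \<epsilon> B))"
  obtain s where s: "source C s = bang\<^sub>0 A \<otimes>\<^sub>0 bang\<^sub>0 B"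
      "target C s = bang\<^sub>0 (bang\<^sub>0 A \<otimes>\<^sub>0 bang\<^sub>0 B)" "s \<Zsemi> r = \<one> (bang\<^sub>0 A \<otimes>\<^sub>0 bang\<^sub>0 B)"
    using bang_pair_section[of A B] by (auto simp: in_hom_def r_def)
  have r: "source C r = bang\<^sub>0 (bang\<^sub>0 A \<otimes>\<^sub>0 bang\<^sub>0 B)" "target C r = bang\<^sub>0 A \<otimes>\<^sub>0 bang\<^sub>0 B"
    by (simp_all add: r_def)
  have "r \<Zsemi> f = r \<Zsemi> g"
    unfolding r_def by (intro eq cofree_morphism_bang) simp_all
  then have "(s \<Zsemi> r) \<Zsemi> f = (s \<Zsemi> r) \<Zsemi> g"
    using fg r s(1,2) by simp
  then show ?thesis
    using fg by (simp add: s(3))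
qed

text \<open>
  Two maps out of \<open>!A \<otimes> !B \<otimes> !D\<close> are compared by first replacing \<open>!B \<otimes> !D\<close> with the cofree coalgebra
  that covers it, which leaves a tensor product of only two factors.
\<close>

lemma triple_separates:
  assumes fg: "source C f = bang\<^sub>0 A \<otimes>\<^sub>0 bang\<^sub>0 B \<otimes>\<^sub>0 bang\<^sub>0 D"
      "source C g = bang\<^sub>0 A \<otimes>\<^sub>0 bang\<^sub>0 B \<otimes>\<^sub>0 bang\<^sub>0 D"
    and eq: "\<And>Z a b d. cofree_morphism Z A a \<Longrightarrow> cofree_morphism Z B b \<Longrightarrow> cofree_morphism Z D d
      \<Longrightarrow> pair Z a (pair Z b d) \<Zsemi> f = pair Z a (pair Z b d) \<Zsemi> g"
  shows "f = g"
proof -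
  define r where
    "r = pair (bang\<^sub>0 B \<otimes>\<^sub>0 bang\<^sub>0 D) (bang (\<epsilon> B \<otimes> e D)) (bang (e B \<otimes> \<epsilon> D))"
  obtain s where s: "source C s = bang\<^sub>0 B \<otimes>\<^sub>0 bang\<^sub>0 D"
      "target C s = bang\<^sub>0 (bang\<^sub>0 B \<otimes>\<^sub>0 bang\<^sub>0 D)" "s \<Zsemi> r = \<one> (bang\<^sub>0 B \<otimes>\<^sub>0 bang\<^sub>0 D)"
    using bang_pair_section[of B D] by (auto simp: in_hom_def r_def)
  have r: "source C r = bang\<^sub>0 (bang\<^sub>0 B \<otimes>\<^sub>0 bang\<^sub>0 D)" "target C r = bang\<^sub>0 B \<otimes>\<^sub>0 bang\<^sub>0 D"
    by (simp_all add: r_def)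
  have "(\<one> (bang\<^sub>0 A) \<otimes> r) \<Zsemi> f = (\<one> (bang\<^sub>0 A) \<otimes> r) \<Zsemi> g"
  proof (rule pair_separates)
    fix Z a b
    assume a: "cofree_morphism Z A a" and b: "cofree_morphism Z (bang\<^sub>0 B \<otimes>\<^sub>0 bang\<^sub>0 D) b"
    have "pair Z a (b \<Zsemi> r) \<Zsemi> f = pair Z a (b \<Zsemi> r) \<Zsemi> g"
      using b by (simp add: r_def) (intro eq a cofree_morphism_seq[OF b] cofree_morphism_bang, simp_all)
    then show "pair Z a b \<Zsemi> ((\<one> (bang\<^sub>0 A) \<otimes> r) \<Zsemi> f) = pair Z a b \<Zsemi> ((\<one> (bang\<^sub>0 A) \<otimes> r) \<Zsemi> g)"
      using a b r fg by simp
  qed (use fg r in simp_all)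
  then have "(\<one> (bang\<^sub>0 A) \<otimes> s) \<Zsemi> ((\<one> (bang\<^sub>0 A) \<otimes> r) \<Zsemi> f)
      = (\<one> (bang\<^sub>0 A) \<otimes> s) \<Zsemi> ((\<one> (bang\<^sub>0 A) \<otimes> r) \<Zsemi> g)"
    by simp
  then show ?thesis
    using fg r s by (simp add: interchange_seq)
qed

lemma pair_add:
  assumes "source C f = bang\<^sub>0 Z" "source C g = bang\<^sub>0 Z" "source C h = bang\<^sub>0 Z" "target C g = target C h"
  shows "pair Z f (g \<oplus> h) = pair Z f g \<oplus> pair Z f h"
    "pair Z (g \<oplus> h) f = pair Z g f \<oplus> pair Z h f"
  using assms by (simp_all add: pair_def tensor_add_eq add_tensor_eq seq_add_eq)

lemma pair_zero [simp]:
  assumes "source C f = bang\<^sub>0 Z"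
  shows "pair Z f (\<zero> (bang\<^sub>0 Z) A) = \<zero> (bang\<^sub>0 Z) (target C f \<otimes>\<^sub>0 A)"
    "pair Z (\<zero> (bang\<^sub>0 Z) A) f = \<zero> (bang\<^sub>0 Z) (A \<otimes>\<^sub>0 target C f)"
  using assms by (simp_all add: pair_def)

text \<open>
  The composite of \<open>\<langle>a, b\<rangle>\<close> with \<open>\<nabla> A \<Zsemi> \<epsilon> A\<close>. Of \<open>a\<close> and \<open>b\<close> being coalgebra maps only the effect on
  \<open>e\<close> enters the hypotheses, which rewriting can establish for nested pairings as well.
\<close>

lemma pair_seq_add_eps [simp]:
  assumes "source C a = bang\<^sub>0 Z" "target C a = bang\<^sub>0 A" "a \<Zsemi> e A = e Z"
    and "source C b = bang\<^sub>0 Z" "target C b = bang\<^sub>0 A" "b \<Zsemi> e A = e Z"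
  shows "pair Z a b \<Zsemi> ((e A \<otimes> \<epsilon> A) \<oplus> (\<epsilon> A \<otimes> e A)) = (b \<Zsemi> \<epsilon> A) \<oplus> (a \<Zsemi> \<epsilon> A)"
  using assms by (simp add: seq_add_eq)

text \<open>
  The object of the counit is a separate variable here, as the unit laws may have simplified
  the tensor product.
\<close>

lemma m_seq_eps_eq [simp]:
  "D = A \<otimes>\<^sub>0 B \<Longrightarrow> m A B \<Zsemi> \<epsilon> D = \<epsilon> A \<otimes> \<epsilon> B"
  by simp

lemma m_seq_eps_seq [simp]:
  assumes "D = A \<otimes>\<^sub>0 B" "source C f = D"
  shows "m A B \<Zsemi> (\<epsilon> D \<Zsemi> f) = (\<epsilon> A \<otimes> \<epsilon> B) \<Zsemi> f"
  using assms by (simp add: seq_seq[symmetric] del: seq_seq)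

lemma mI_seq_eps_seq [simp]:
  assumes "source C f = \<I>"
  shows "m\<^sub>I \<Zsemi> (\<epsilon> \<I> \<Zsemi> f) = f"
  using assms by (simp add: seq_seq[symmetric] del: seq_seq)

lemma nabla_seq_eps_seq [simp]:
  assumes "source C f = A"
  shows "\<nabla> A \<Zsemi> (\<epsilon> A \<Zsemi> f) = ((e A \<otimes> \<epsilon> A) \<oplus> (\<epsilon> A \<otimes> e A)) \<Zsemi> f"
  using assms by (simp add: seq_seq[symmetric] del: seq_seq)

lemma pair_seq_add_eps_seq [simp]:
  assumes "source C a = bang\<^sub>0 Z" "target C a = bang\<^sub>0 A" "a \<Zsemi> e A = e Z"
    and "source C b = bang\<^sub>0 Z" "target C b = bang\<^sub>0 A" "b \<Zsemi> e A = e Z"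
    and "source C f = A"
  shows "pair Z a b \<Zsemi> (((e A \<otimes> \<epsilon> A) \<oplus> (\<epsilon> A \<otimes> e A)) \<Zsemi> f) = (b \<Zsemi> (\<epsilon> A \<Zsemi> f)) \<oplus> (a \<Zsemi> (\<epsilon> A \<Zsemi> f))"
  using assms by (simp add: add_seq_eq seq_add_eq tensor_scalar_left tensor_scalar_right)

lemma u_seq_eps_seq [simp]:
  assumes "source C f = A"
  shows "u A \<Zsemi> (\<epsilon> A \<Zsemi> f) = \<zero> \<I> (target C f)"
  using assms by (simp add: seq_seq[symmetric] del: seq_seq)

lemma m_seq_e [simp]: "m A B \<Zsemi> e (A \<otimes>\<^sub>0 B) = e A \<otimes> e B"
proof (rule pair_separates)
  fix Z a b
  assume ab: "cofree_morphism Z A a" "cofree_morphism Z B b"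
  have "(pair Z a b \<Zsemi> m A B) \<Zsemi> e (A \<otimes>\<^sub>0 B) = e Z"
    using ab by (intro cofree_morphism_e cofree_morphism_m)
  then show "pair Z a b \<Zsemi> (m A B \<Zsemi> e (A \<otimes>\<^sub>0 B)) = pair Z a b \<Zsemi> (e A \<otimes> e B)"
    using ab by simp
qed simp_all

lemma nabla_seq_e [simp]: "\<nabla> A \<Zsemi> e A = e A \<otimes> e A"
proof (rule pair_separates)
  fix Z a b
  assume ab: "cofree_morphism Z A a" "cofree_morphism Z A b"
  have "(pair Z a b \<Zsemi> \<nabla> A) \<Zsemi> e A = e Z"
    using ab by (intro cofree_morphism_e cofree_morphism_nabla)
  then show "pair Z a b \<Zsemi> (\<nabla> A \<Zsemi> e A) = pair Z a b \<Zsemi> (e A \<otimes> e A)"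
    using ab by simp
qed simp_all

lemma mI_seq_e [simp]: "m\<^sub>I \<Zsemi> e \<I> = \<one> \<I>"
  by (rule e_separates)
    (use cofree_morphism_e[OF cofree_morphism_mI, of \<I>] in simp_all)

lemma u_seq_e [simp]: "u A \<Zsemi> e A = \<one> \<I>"
  by (rule e_separates)
    (use cofree_morphism_e[OF cofree_morphism_u, of \<I>] in simp_all)

lemma cofree_morphism_m_eq:
  "cofree_morphism Z A a \<Longrightarrow> cofree_morphism Z B b \<Longrightarrow> D = A \<otimes>\<^sub>0 B
    \<Longrightarrow> cofree_morphism Z D (pair Z a b \<Zsemi> m A B)"
  using cofree_morphism_m by simp

lemmas cofree_morphism_intros = cofree_morphism_m_eq cofree_morphism_mI cofree_morphism_nabla
  cofree_morphism_u cofree_morphism_delta cofree_morphism_bang cofree_morphism_ident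
  cofree_morphism_delta_bang cofree_morphism_seq

text \<open>
  Each of the following axioms is an equation between maps out of \<open>I\<close>, \<open>!A\<close> or a tensor product of
  two or three such objects. After composition with a generalized exponential both sides are
  coalgebra maps with the same composite with \<open>\<epsilon>\<close>, or, for the comultiplication of a
  structure map, both sides are computed from the fact that coalgebra maps preserve \<open>\<Delta>\<close>.
\<close>

lemma m_natural_eq:
  assumes f: "source C f = X" "target C f = Y" and g: "source C g = V" "target C g = W"
  shows "(bang f \<otimes> bang g) \<Zsemi> m Y W = m X V \<Zsemi> bang (f \<otimes> g)"
proof (rule pair_separates)
  fix Z a b
  assume ab: "cofree_morphism Z X a" "cofree_morphism Z V b"
  have "pair Z (a \<Zsemi> bang f) (b \<Zsemi> bang g) \<Zsemi> m Y W = (pair Z a b \<Zsemi> m X V) \<Zsemi> bang (f \<otimes> g)"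
    by (rule cofree_morphism_ext[of Z "Y \<otimes>\<^sub>0 W"])
      ((rule cofree_morphism_intros | use f g ab in simp)+)
  then show "pair Z a b \<Zsemi> ((bang f \<otimes> bang g) \<Zsemi> m Y W) = pair Z a b \<Zsemi> (m X V \<Zsemi> bang (f \<otimes> g))"
    using f g ab by simp
qed (use f g in simp_all)

lemma m_assoc_eq:
  "(m X Y \<otimes> \<one> (bang\<^sub>0 W)) \<Zsemi> m (X \<otimes>\<^sub>0 Y) W = (\<one> (bang\<^sub>0 X) \<otimes> m Y W) \<Zsemi> m X (Y \<otimes>\<^sub>0 W)"
proof (rule triple_separates)
  fix Z a b d
  assume pts: "cofree_morphism Z X a" "cofree_morphism Z Y b" "cofree_morphism Z W d"
  have "pair Z (pair Z a b \<Zsemi> m X Y) d \<Zsemi> m (X \<otimes>\<^sub>0 Y) W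
      = pair Z a (pair Z b d \<Zsemi> m Y W) \<Zsemi> m X (Y \<otimes>\<^sub>0 W)"
    by (rule cofree_morphism_ext[of Z "X \<otimes>\<^sub>0 Y \<otimes>\<^sub>0 W"])
      ((rule cofree_morphism_intros | use pts in \<open>simp add: pair_assoc\<close>)+)
  then show "pair Z a (pair Z b d) \<Zsemi> ((m X Y \<otimes> \<one> (bang\<^sub>0 W)) \<Zsemi> m (X \<otimes>\<^sub>0 Y) W)
      = pair Z a (pair Z b d) \<Zsemi> ((\<one> (bang\<^sub>0 X) \<otimes> m Y W) \<Zsemi> m X (Y \<otimes>\<^sub>0 W))"
    using pts by (subst pair_assoc[symmetric]) simp_all
qed simp_all

lemma m_unit_left_eq: "(m\<^sub>I \<otimes> \<one> (bang\<^sub>0 A)) \<Zsemi> m \<I> A = \<one> (bang\<^sub>0 A)"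
proof -
  have "pair A (e A \<Zsemi> m\<^sub>I) (\<one> (bang\<^sub>0 A)) \<Zsemi> m \<I> A = \<one> (bang\<^sub>0 A)"
    by (rule cofree_morphism_ext[of A A])
      ((rule cofree_morphism_intros | simp)+)
  then show ?thesis
    by (simp add: pair_e_seq)
qed

lemma m_unit_right_eq: "(\<one> (bang\<^sub>0 A) \<otimes> m\<^sub>I) \<Zsemi> m A \<I> = \<one> (bang\<^sub>0 A)"
proof -
  have "pair A (\<one> (bang\<^sub>0 A)) (e A \<Zsemi> m\<^sub>I) \<Zsemi> m A \<I> = \<one> (bang\<^sub>0 A)"
    by (rule cofree_morphism_ext[of A A])
      ((rule cofree_morphism_intros | simp)+)
  then show ?thesis
    by (simp add: pair_e_seq)
qed

lemma m_symm_eq: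
  "m A B \<Zsemi> bang (\<sigma> A B) = \<sigma> (bang\<^sub>0 A) (bang\<^sub>0 B) \<Zsemi> m B A"
proof (rule pair_separates)
  fix Z a b
  assume pts: "cofree_morphism Z A a" "cofree_morphism Z B b"
  have "(pair Z a b \<Zsemi> m A B) \<Zsemi> bang (\<sigma> A B) = pair Z b a \<Zsemi> m B A"
    by (rule cofree_morphism_ext[of Z "B \<otimes>\<^sub>0 A"])
      ((rule cofree_morphism_intros | use pts in \<open>simp add: pair_symm\<close>)+)
  then show "pair Z a b \<Zsemi> (m A B \<Zsemi> bang (\<sigma> A B))
      = pair Z a b \<Zsemi> (\<sigma> (bang\<^sub>0 A) (bang\<^sub>0 B) \<Zsemi> m B A)"
    using pts by (simp add: pair_symm_seq)
qed simp_all

lemma m_seq_delta: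
  "m A B \<Zsemi> \<delta> (A \<otimes>\<^sub>0 B) = (\<delta> A \<otimes> \<delta> B) \<Zsemi> m (bang\<^sub>0 A) (bang\<^sub>0 B) \<Zsemi> bang (m A B)"
proof (rule pair_separates)
  fix Z a b
  assume pts: "cofree_morphism Z A a" "cofree_morphism Z B b"
  have "(pair Z a b \<Zsemi> m A B) \<Zsemi> \<delta> (A \<otimes>\<^sub>0 B)
      = (pair Z (a \<Zsemi> \<delta> A) (b \<Zsemi> \<delta> B) \<Zsemi> m (bang\<^sub>0 A) (bang\<^sub>0 B)) \<Zsemi> bang (m A B)"
    by (rule cofree_morphism_ext[of Z "bang\<^sub>0 (A \<otimes>\<^sub>0 B)"])
      ((rule cofree_morphism_intros | use pts in simp)+)
  then show "pair Z a b \<Zsemi> (m A B \<Zsemi> \<delta> (A \<otimes>\<^sub>0 B))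
      = pair Z a b \<Zsemi> ((\<delta> A \<otimes> \<delta> B) \<Zsemi> m (bang\<^sub>0 A) (bang\<^sub>0 B) \<Zsemi> bang (m A B))"
    using pts by simp
qed simp_all

lemma mI_seq_delta:
  "m\<^sub>I \<Zsemi> \<delta> \<I> = m\<^sub>I \<Zsemi> bang m\<^sub>I"
proof (rule e_separates)
  have "(e \<I> \<Zsemi> m\<^sub>I) \<Zsemi> \<delta> \<I> = (e \<I> \<Zsemi> m\<^sub>I) \<Zsemi> bang m\<^sub>I"
    by (rule cofree_morphism_ext[of \<I> "bang\<^sub>0 \<I>"])
      ((rule cofree_morphism_intros | simp)+)
  then show "e \<I> \<Zsemi> (m\<^sub>I \<Zsemi> \<delta> \<I>) = e \<I> \<Zsemi> (m\<^sub>I \<Zsemi> bang m\<^sub>I)"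
    by simp
qed simp_all

lemma m_seq_Delta:
  "m A B \<Zsemi> \<Delta> (A \<otimes>\<^sub>0 B)
    = (\<Delta> A \<otimes> \<Delta> B) \<Zsemi> (\<one> (bang\<^sub>0 A) \<otimes> \<sigma> (bang\<^sub>0 A) (bang\<^sub>0 B) \<otimes> \<one> (bang\<^sub>0 B)) \<Zsemi> (m A B \<otimes> m A B)"
proof (rule pair_separates)
  fix Z a b
  assume a: "cofree_morphism Z A a" and b: "cofree_morphism Z B b"
  have "(pair Z a b \<Zsemi> m A B) \<Zsemi> \<Delta> (A \<otimes>\<^sub>0 B) = pair Z (pair Z a b \<Zsemi> m A B) (pair Z a b \<Zsemi> m A B)"
    by (intro cofree_morphism_Delta cofree_morphism_m a b)
  then show "pair Z a b \<Zsemi> (m A B \<Zsemi> \<Delta> (A \<otimes>\<^sub>0 B))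
      = pair Z a b \<Zsemi> ((\<Delta> A \<otimes> \<Delta> B) \<Zsemi> (\<one> (bang\<^sub>0 A) \<otimes> \<sigma> (bang\<^sub>0 A) (bang\<^sub>0 B) \<otimes> \<one> (bang\<^sub>0 B))
          \<Zsemi> (m A B \<otimes> m A B))"
    using a b by (simp add: cofree_morphism_Delta[OF a] cofree_morphism_Delta[OF b]
      pair_middle_four_seq)
qed simp_all

lemma mI_seq_Delta: "m\<^sub>I \<Zsemi> \<Delta> \<I> = m\<^sub>I \<otimes> m\<^sub>I"
  by (rule e_separates)
    (use cofree_morphism_Delta[OF cofree_morphism_mI, of \<I>] in \<open>simp_all add: pair_e_e\<close>)

lemma delta_bang_Delta_eq:
  "\<delta> A \<Zsemi> bang (\<Delta> A) = \<Delta> A \<Zsemi> (\<delta> A \<otimes> \<delta> A) \<Zsemi> m (bang\<^sub>0 A) (bang\<^sub>0 A)"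
proof -
  have "\<delta> A \<Zsemi> bang (\<Delta> A) = pair A (\<delta> A) (\<delta> A) \<Zsemi> m (bang\<^sub>0 A) (bang\<^sub>0 A)"
    by (rule cofree_morphism_ext[of A "bang\<^sub>0 A \<otimes>\<^sub>0 bang\<^sub>0 A"])
      ((rule cofree_morphism_intros | simp)+)
  then show ?thesis
    by (simp add: pair_def)
qed

lemma delta_bang_e_eq: "\<delta> A \<Zsemi> bang (e A) = e A \<Zsemi> m\<^sub>I"
  by (rule cofree_morphism_ext[of A \<I>]) ((rule cofree_morphism_intros | simp)+)

lemma nabla_natural_eq:
  assumes f: "source C f = X" "target C f = Y"
  shows "(bang f \<otimes> bang f) \<Zsemi> \<nabla> Y = \<nabla> X \<Zsemi> bang f"
proof (rule pair_separates)
  fix Z a b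
  assume pts: "cofree_morphism Z X a" "cofree_morphism Z X b"
  have "pair Z (a \<Zsemi> bang f) (b \<Zsemi> bang f) \<Zsemi> \<nabla> Y = (pair Z a b \<Zsemi> \<nabla> X) \<Zsemi> bang f"
    by (rule cofree_morphism_ext[of Z Y])
      ((rule cofree_morphism_intros | use pts f in simp)+)
  then show "pair Z a b \<Zsemi> ((bang f \<otimes> bang f) \<Zsemi> \<nabla> Y) = pair Z a b \<Zsemi> (\<nabla> X \<Zsemi> bang f)"
    using pts f by simp
qed (use f in simp_all)

lemma u_natural_eq:
  assumes f: "source C f = X" "target C f = Y"
  shows "u X \<Zsemi> bang f = u Y"
proof (rule e_separates)
  have "(e \<I> \<Zsemi> u X) \<Zsemi> bang f = e \<I> \<Zsemi> u Y"
    by (rule cofree_morphism_ext[of \<I> Y])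
      ((rule cofree_morphism_intros | use f in simp)+)
  then show "e \<I> \<Zsemi> (u X \<Zsemi> bang f) = e \<I> \<Zsemi> u Y"
    using f by simp
qed (use f in simp_all)

lemma nabla_assoc_eq:
  "(\<nabla> A \<otimes> \<one> (bang\<^sub>0 A)) \<Zsemi> \<nabla> A = (\<one> (bang\<^sub>0 A) \<otimes> \<nabla> A) \<Zsemi> \<nabla> A"
proof (rule triple_separates)
  fix Z a b d
  assume pts: "cofree_morphism Z A a" "cofree_morphism Z A b" "cofree_morphism Z A d"
  have "pair Z (pair Z a b \<Zsemi> \<nabla> A) d \<Zsemi> \<nabla> A = pair Z a (pair Z b d \<Zsemi> \<nabla> A) \<Zsemi> \<nabla> A"
    by (rule cofree_morphism_ext[of Z A])
      ((rule cofree_morphism_intros | use pts in \<open>simp add: add_assoc_eq\<close>)+)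
  then show "pair Z a (pair Z b d) \<Zsemi> ((\<nabla> A \<otimes> \<one> (bang\<^sub>0 A)) \<Zsemi> \<nabla> A)
      = pair Z a (pair Z b d) \<Zsemi> ((\<one> (bang\<^sub>0 A) \<otimes> \<nabla> A) \<Zsemi> \<nabla> A)"
    using pts by (subst pair_assoc[symmetric]) simp_all
qed simp_all

lemma nabla_unit_left_eq: "(u A \<otimes> \<one> (bang\<^sub>0 A)) \<Zsemi> \<nabla> A = \<one> (bang\<^sub>0 A)"
proof -
  have "pair A (e A \<Zsemi> u A) (\<one> (bang\<^sub>0 A)) \<Zsemi> \<nabla> A = \<one> (bang\<^sub>0 A)"
    by (rule cofree_morphism_ext[of A A])
      ((rule cofree_morphism_intros | simp)+)
  then show ?thesis
    by (simp add: pair_e_seq)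
qed

lemma nabla_unit_right_eq: "(\<one> (bang\<^sub>0 A) \<otimes> u A) \<Zsemi> \<nabla> A = \<one> (bang\<^sub>0 A)"
proof -
  have "pair A (\<one> (bang\<^sub>0 A)) (e A \<Zsemi> u A) \<Zsemi> \<nabla> A = \<one> (bang\<^sub>0 A)"
    by (rule cofree_morphism_ext[of A A])
      ((rule cofree_morphism_intros | simp)+)
  then show ?thesis
    by (simp add: pair_e_seq)
qed

lemma nabla_comm_eq:
  "\<sigma> (bang\<^sub>0 A) (bang\<^sub>0 A) \<Zsemi> \<nabla> A = \<nabla> A"
proof (rule pair_separates)
  fix Z a b
  assume pts: "cofree_morphism Z A a" "cofree_morphism Z A b"
  have "pair Z b a \<Zsemi> \<nabla> A = pair Z a b \<Zsemi> \<nabla> A"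
    by (rule cofree_morphism_ext[of Z A])
      ((rule cofree_morphism_intros add_commute_eq | use pts in simp)+)
  then show "pair Z a b \<Zsemi> (\<sigma> (bang\<^sub>0 A) (bang\<^sub>0 A) \<Zsemi> \<nabla> A) = pair Z a b \<Zsemi> \<nabla> A"
    using pts by (simp add: pair_symm_seq)
qed simp_all

lemma nabla_seq_Delta:
  "\<nabla> A \<Zsemi> \<Delta> A
    = (\<Delta> A \<otimes> \<Delta> A) \<Zsemi> (\<one> (bang\<^sub>0 A) \<otimes> \<sigma> (bang\<^sub>0 A) (bang\<^sub>0 A) \<otimes> \<one> (bang\<^sub>0 A)) \<Zsemi> (\<nabla> A \<otimes> \<nabla> A)"
proof (rule pair_separates)
  fix Z a b
  assume a: "cofree_morphism Z A a" and b: "cofree_morphism Z A b"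
  have "(pair Z a b \<Zsemi> \<nabla> A) \<Zsemi> \<Delta> A = pair Z (pair Z a b \<Zsemi> \<nabla> A) (pair Z a b \<Zsemi> \<nabla> A)"
    by (intro cofree_morphism_Delta cofree_morphism_nabla a b)
  then show "pair Z a b \<Zsemi> (\<nabla> A \<Zsemi> \<Delta> A)
      = pair Z a b \<Zsemi> ((\<Delta> A \<otimes> \<Delta> A) \<Zsemi> (\<one> (bang\<^sub>0 A) \<otimes> \<sigma> (bang\<^sub>0 A) (bang\<^sub>0 A) \<otimes> \<one> (bang\<^sub>0 A))
          \<Zsemi> (\<nabla> A \<otimes> \<nabla> A))"
    using a b by (simp add: cofree_morphism_Delta[OF a] cofree_morphism_Delta[OF b]
      pair_middle_four_seq)
qed simp_all

lemma u_seq_Delta: "u A \<Zsemi> \<Delta> A = u A \<otimes> u A"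
  by (rule e_separates)
    (use cofree_morphism_Delta[OF cofree_morphism_u, of \<I>] in \<open>simp_all add: pair_e_e\<close>)

lemma bang_add_eq:
  assumes "source C f = X" "target C f = Y" "source C g = X" "target C g = Y"
  shows "bang (f \<oplus> g) = \<Delta> X \<Zsemi> (bang f \<otimes> bang g) \<Zsemi> \<nabla> Y"
proof -
  have "bang (f \<oplus> g) = pair X (bang f) (bang g) \<Zsemi> \<nabla> Y"
    by (rule cofree_morphism_ext[of X Y])
      ((rule cofree_morphism_intros add_commute_eq | use assms in \<open>simp add: seq_add_eq\<close>)+)
  then show ?thesis
    using assms by (simp add: pair_def)
qed

lemma bang_zero_eq: "bang (\<zero> X Y) = e X \<Zsemi> u Y"
  by (rule cofree_morphism_ext[of X Y]) ((rule cofree_morphism_intros | simp)+)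

lemma nabla_m_right_eq:
  "(\<one> (bang\<^sub>0 A) \<otimes> \<nabla> B) \<Zsemi> m A B
    = (\<Delta> A \<otimes> \<one> (bang\<^sub>0 B) \<otimes> \<one> (bang\<^sub>0 B)) \<Zsemi> (\<one> (bang\<^sub>0 A) \<otimes> \<sigma> (bang\<^sub>0 A) (bang\<^sub>0 B) \<otimes> \<one> (bang\<^sub>0 B))
        \<Zsemi> (m A B \<otimes> m A B) \<Zsemi> \<nabla> (A \<otimes>\<^sub>0 B)"
proof (rule triple_separates)
  fix Z a b d
  assume pts: "cofree_morphism Z A a" "cofree_morphism Z B b" "cofree_morphism Z B d"
  have "pair Z a (pair Z b d \<Zsemi> \<nabla> B) \<Zsemi> m A B
      = pair Z (pair Z a b \<Zsemi> m A B) (pair Z a d \<Zsemi> m A B) \<Zsemi> \<nabla> (A \<otimes>\<^sub>0 B)"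
    by (rule cofree_morphism_ext[of Z "A \<otimes>\<^sub>0 B"])
      ((rule cofree_morphism_intros | use pts in \<open>simp add: pair_add\<close>)+)
  then show "pair Z a (pair Z b d) \<Zsemi> ((\<one> (bang\<^sub>0 A) \<otimes> \<nabla> B) \<Zsemi> m A B)
      = pair Z a (pair Z b d) \<Zsemi> ((\<Delta> A \<otimes> \<one> (bang\<^sub>0 B) \<otimes> \<one> (bang\<^sub>0 B))
          \<Zsemi> (\<one> (bang\<^sub>0 A) \<otimes> \<sigma> (bang\<^sub>0 A) (bang\<^sub>0 B) \<otimes> \<one> (bang\<^sub>0 B)) \<Zsemi> (m A B \<otimes> m A B) \<Zsemi> \<nabla> (A \<otimes>\<^sub>0 B))"
    using pts by (simp add: cofree_morphism_Delta pair_middle_four_seq)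
qed simp_all

lemma nabla_m_left_eq:
  "(\<nabla> A \<otimes> \<one> (bang\<^sub>0 B)) \<Zsemi> m A B
    = (\<one> (bang\<^sub>0 A) \<otimes> \<one> (bang\<^sub>0 A) \<otimes> \<Delta> B) \<Zsemi> (\<one> (bang\<^sub>0 A) \<otimes> \<sigma> (bang\<^sub>0 A) (bang\<^sub>0 B) \<otimes> \<one> (bang\<^sub>0 B))
        \<Zsemi> (m A B \<otimes> m A B) \<Zsemi> \<nabla> (A \<otimes>\<^sub>0 B)"
proof (rule triple_separates)
  fix Z a b d
  assume pts: "cofree_morphism Z A a" "cofree_morphism Z A b" "cofree_morphism Z B d"
  have "pair Z (pair Z a b \<Zsemi> \<nabla> A) d \<Zsemi> m A B
      = pair Z (pair Z a d \<Zsemi> m A B) (pair Z b d \<Zsemi> m A B) \<Zsemi> \<nabla> (A \<otimes>\<^sub>0 B)"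
    by (rule cofree_morphism_ext[of Z "A \<otimes>\<^sub>0 B"])
      ((rule cofree_morphism_intros | use pts in \<open>simp add: pair_add\<close>)+)
  moreover have "pair Z a (pair Z b d) \<Zsemi> ((\<nabla> A \<otimes> \<one> (bang\<^sub>0 B)) \<Zsemi> m A B)
      = pair Z (pair Z a b \<Zsemi> \<nabla> A) d \<Zsemi> m A B"
    using pts by (subst pair_assoc[symmetric]) simp_all
  \<comment> \<open>The tail \<open>w\<close> stays opaque until the nested pairing has been regrouped for the interchange.\<close>
  moreover have "pair Z a (pair Z b d) \<Zsemi> ((\<one> (bang\<^sub>0 A) \<otimes> \<one> (bang\<^sub>0 A) \<otimes> \<Delta> B) \<Zsemi> w)
      = pair Z (pair Z a d \<Zsemi> m A B) (pair Z b d \<Zsemi> m A B) \<Zsemi> \<nabla> (A \<otimes>\<^sub>0 B)"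
    if w: "w = (\<one> (bang\<^sub>0 A) \<otimes> \<sigma> (bang\<^sub>0 A) (bang\<^sub>0 B) \<otimes> \<one> (bang\<^sub>0 B))
          \<Zsemi> ((m A B \<otimes> m A B) \<Zsemi> \<nabla> (A \<otimes>\<^sub>0 B))" for w
  proof -
    have "source C w = bang\<^sub>0 A \<otimes>\<^sub>0 bang\<^sub>0 A \<otimes>\<^sub>0 bang\<^sub>0 B \<otimes>\<^sub>0 bang\<^sub>0 B"
      by (simp add: w)
    then have "pair Z a (pair Z b d) \<Zsemi> ((\<one> (bang\<^sub>0 A) \<otimes> \<one> (bang\<^sub>0 A) \<otimes> \<Delta> B) \<Zsemi> w)
        = pair Z a (pair Z b (pair Z d d)) \<Zsemi> w"
      using pts by (simp add: cofree_morphism_Delta)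
    also have "\<dots> = pair Z (pair Z a b) (pair Z d d) \<Zsemi> w"
      using pts by (subst pair_assoc) simp_all
    finally show ?thesis
      using pts by (simp add: w pair_middle_four_seq)
  qed
  ultimately show "pair Z a (pair Z b d) \<Zsemi> ((\<nabla> A \<otimes> \<one> (bang\<^sub>0 B)) \<Zsemi> m A B)
      = pair Z a (pair Z b d) \<Zsemi> ((\<one> (bang\<^sub>0 A) \<otimes> \<one> (bang\<^sub>0 A) \<otimes> \<Delta> B)
          \<Zsemi> (\<one> (bang\<^sub>0 A) \<otimes> \<sigma> (bang\<^sub>0 A) (bang\<^sub>0 B) \<otimes> \<one> (bang\<^sub>0 B)) \<Zsemi> (m A B \<otimes> m A B) \<Zsemi> \<nabla> (A \<otimes>\<^sub>0 B))"
    by simp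
qed simp_all

lemma u_m_left_eq: "(u A \<otimes> \<one> (bang\<^sub>0 B)) \<Zsemi> m A B = e B \<Zsemi> u (A \<otimes>\<^sub>0 B)"
proof -
  have "pair B (e B \<Zsemi> u A) (\<one> (bang\<^sub>0 B)) \<Zsemi> m A B = e B \<Zsemi> u (A \<otimes>\<^sub>0 B)"
    by (rule cofree_morphism_ext[of B "A \<otimes>\<^sub>0 B"])
      ((rule cofree_morphism_intros | simp)+)
  then show ?thesis
    by (simp add: pair_e_seq)
qed

lemma u_m_right_eq: "(\<one> (bang\<^sub>0 A) \<otimes> u B) \<Zsemi> m A B = e A \<Zsemi> u (A \<otimes>\<^sub>0 B)"
proof -
  have "pair A (\<one> (bang\<^sub>0 A)) (e A \<Zsemi> u B) \<Zsemi> m A B = e A \<Zsemi> u (A \<otimes>\<^sub>0 B)"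
    by (rule cofree_morphism_ext[of A "A \<otimes>\<^sub>0 B"])
      ((rule cofree_morphism_intros | simp)+)
  then show ?thesis
    by (simp add: pair_e_seq)
qed

lemma nabla_seq_delta:
  "\<nabla> A \<Zsemi> \<delta> A = (\<delta> A \<otimes> \<delta> A) \<Zsemi> m (bang\<^sub>0 A) (bang\<^sub>0 A) \<Zsemi> bang (\<nabla> A)"
proof (rule pair_separates)
  fix Z a b
  assume pts: "cofree_morphism Z A a" "cofree_morphism Z A b"
  have "(pair Z a b \<Zsemi> \<nabla> A) \<Zsemi> \<delta> A
      = (pair Z (a \<Zsemi> \<delta> A) (b \<Zsemi> \<delta> A) \<Zsemi> m (bang\<^sub>0 A) (bang\<^sub>0 A)) \<Zsemi> bang (\<nabla> A)"
    by (rule cofree_morphism_ext[of Z "bang\<^sub>0 A"])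
      ((rule cofree_morphism_intros | use pts in simp)+)
  then show "pair Z a b \<Zsemi> (\<nabla> A \<Zsemi> \<delta> A)
      = pair Z a b \<Zsemi> ((\<delta> A \<otimes> \<delta> A) \<Zsemi> m (bang\<^sub>0 A) (bang\<^sub>0 A) \<Zsemi> bang (\<nabla> A))"
    using pts by simp
qed simp_all

lemma u_seq_delta:
  "u A \<Zsemi> \<delta> A = m\<^sub>I \<Zsemi> bang (u A)"
proof (rule e_separates)
  have "(e \<I> \<Zsemi> u A) \<Zsemi> \<delta> A = (e \<I> \<Zsemi> m\<^sub>I) \<Zsemi> bang (u A)"
    by (rule cofree_morphism_ext[of \<I> "bang\<^sub>0 A"])
      ((rule cofree_morphism_intros | simp)+)
  then show "e \<I> \<Zsemi> (u A \<Zsemi> \<delta> A) = e \<I> \<Zsemi> (m\<^sub>I \<Zsemi> bang (u A))"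
    by simp
qed simp_all

lemma monoidal_bialgebra_modality:
  "monoidal_bialgebra_modality C bang\<^sub>0 bang \<delta> \<epsilon> \<Delta> e m m\<^sub>I nabla u"
  by unfold_locales
    (rule m_assoc_eq m_unit_left_eq m_unit_right_eq m_symm_eq m_seq_delta mI_seq_delta m_seq_eps
      mI_seq_eps m_seq_Delta m_seq_e mI_seq_Delta mI_seq_e delta_bang_Delta_eq delta_bang_e_eq
      nabla_assoc_eq nabla_unit_left_eq nabla_unit_right_eq nabla_comm_eq nabla_seq_Delta
      nabla_seq_e u_seq_Delta u_seq_e nabla_m_right_eq nabla_m_left_eq u_m_left_eq u_m_right_eq
      nabla_seq_delta u_seq_delta
      | simp add: in_hom_def m_natural_eq nabla_natural_eq u_natural_eq)+

lemma monoidal_coalgebra_modality: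
  "monoidal_coalgebra_modality C bang\<^sub>0 bang \<delta> \<epsilon> \<Delta> e m m\<^sub>I"
  using monoidal_bialgebra_modality by (simp add: monoidal_bialgebra_modality_def)

lemma additive_bialgebra_modality:
  "additive_bialgebra_modality C bang\<^sub>0 bang \<delta> \<epsilon> \<Delta> e nabla u"
proof -
  interpret bialgebra_modality C bang\<^sub>0 bang \<delta> \<epsilon> \<Delta> e nabla u
    using monoidal_bialgebra_modality by (simp add: monoidal_bialgebra_modality_def)
  show ?thesis
    by unfold_locales
      (rule nabla_seq_eps u_seq_eps bang_zero_eq | simp add: in_hom_def bang_add_eq)+
qed

end

text \<open>
  Both versions of a structure map have the same values on generalized exponentials. In particular
  a coalgebra modality over an additive category is monoidal, or an additive bialgebra modality, in
  at most one way.
\<close>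

lemma pointwise_modality_unique:
  assumes 1: "pointwise_modality C bang\<^sub>0 bang \<delta> \<epsilon> \<Delta> e m m\<^sub>I nabla u"
    and 2: "pointwise_modality C bang\<^sub>0 bang \<delta> \<epsilon> \<Delta> e m' m\<^sub>I' nabla' u'"
  shows "m = m' \<and> m\<^sub>I = m\<^sub>I' \<and> nabla = nabla' \<and> u = u'"
proof -
  interpret P: pointwise_modality C bang\<^sub>0 bang \<delta> \<epsilon> \<Delta> e m m\<^sub>I nabla u
    by (fact 1)
  interpret Q: pointwise_modality C bang\<^sub>0 bang \<delta> \<epsilon> \<Delta> e m' m\<^sub>I' nabla' u'
    by (fact 2)
  have "m A B = m' A B" for A B
  proof (rule P.pair_separates)
    fix Z a b
    assume ab: "P.cofree_morphism Z A a" "P.cofree_morphism Z B b"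
    show "seq C (P.pair Z a b) (m A B) = seq C (P.pair Z a b) (m' A B)"
      by (rule P.cofree_morphism_ext[OF P.cofree_morphism_m[OF ab] Q.cofree_morphism_m[OF ab]])
        (use ab in simp)
  qed simp_all
  moreover have "nabla A = nabla' A" for A
  proof (rule P.pair_separates)
    fix Z a b
    assume ab: "P.cofree_morphism Z A a" "P.cofree_morphism Z A b"
    show "seq C (P.pair Z a b) (nabla A) = seq C (P.pair Z a b) (nabla' A)"
      by (rule P.cofree_morphism_ext[OF P.cofree_morphism_nabla[OF ab] Q.cofree_morphism_nabla[OF ab]])
        (use ab in simp)
  qed simp_all
  moreover have "m\<^sub>I = m\<^sub>I'"
    by (rule P.e_separates) (simp_all add:
        P.cofree_morphism_ext[OF P.cofree_morphism_mI Q.cofree_morphism_mI])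
  moreover have "u A = u' A" for A
    by (rule P.e_separates) (simp_all add:
        P.cofree_morphism_ext[OF P.cofree_morphism_u Q.cofree_morphism_u])
  ultimately show ?thesis
    by blast
qed

section \<open>Monoidal coalgebra modalities\<close>

context monoidal_coalgebra_modality
begin

lemma source_target_monoidal [simp]:
  "source C (m A B) = bang\<^sub>0 A \<otimes>\<^sub>0 bang\<^sub>0 B" "target C (m A B) = bang\<^sub>0 (A \<otimes>\<^sub>0 B)"
  "source C m\<^sub>I = \<I>" "target C m\<^sub>I = bang\<^sub>0 \<I>"
  using m_in_hom mI_in_hom by (auto simp: in_hom_def)

text \<open>
  The maps \<open>\<Delta>\<close>, \<open>a \<otimes> b\<close> and \<open>m\<close> are coalgebra maps for the coalgebra structures
  \<open>(\<delta> \<otimes> \<delta>) \<Zsemi> m\<close> on tensor products; the calculation spells out their composite.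
\<close>

lemma cofree_morphism_pair_m:
  assumes a: "cofree_morphism Z A a" and b: "cofree_morphism Z B b"
  shows "cofree_morphism Z (A \<otimes>\<^sub>0 B) (pair Z a b \<Zsemi> m A B)"
proof (rule cofree_morphismI)
  have "(pair Z a b \<Zsemi> m A B) \<Zsemi> \<delta> (A \<otimes>\<^sub>0 B)
      = pair Z (a \<Zsemi> \<delta> A) (b \<Zsemi> \<delta> B) \<Zsemi> (m (bang\<^sub>0 A) (bang\<^sub>0 B) \<Zsemi> bang (m A B))"
    using a b by (simp add: m_delta)
  also have "\<dots> = pair Z (\<delta> Z) (\<delta> Z)
      \<Zsemi> (((bang a \<otimes> bang b) \<Zsemi> m (bang\<^sub>0 A) (bang\<^sub>0 B)) \<Zsemi> bang (m A B))"
    using a b by (simp add: cofree_morphism_seq_delta)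
  also have "(bang a \<otimes> bang b) \<Zsemi> m (bang\<^sub>0 A) (bang\<^sub>0 B)
      = m (bang\<^sub>0 Z) (bang\<^sub>0 Z) \<Zsemi> bang (a \<otimes> b)"
    using a b by (intro m_natural) (simp_all add: in_hom_def)
  also have "pair Z (\<delta> Z) (\<delta> Z) \<Zsemi> (\<dots> \<Zsemi> bang (m A B))
      = (\<Delta> Z \<Zsemi> (\<delta> Z \<otimes> \<delta> Z) \<Zsemi> m (bang\<^sub>0 Z) (bang\<^sub>0 Z)) \<Zsemi> bang ((a \<otimes> b) \<Zsemi> m A B)"
    using a b by (simp add: pair_def bang_seq_eq)
  also have "\<dots> = \<delta> Z \<Zsemi> bang (pair Z a b \<Zsemi> m A B)"
    using a b by (simp add: delta_bang_Delta[symmetric] pair_def bang_seq_eq)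
  finally show "(pair Z a b \<Zsemi> m A B) \<Zsemi> \<delta> (A \<otimes>\<^sub>0 B) = \<delta> Z \<Zsemi> bang (pair Z a b \<Zsemi> m A B)" .
qed (use a b in simp_all)

lemma cofree_morphism_e_mI: "cofree_morphism Z \<I> (e Z \<Zsemi> m\<^sub>I)"
  using cofree_morphism_delta_bang[of "e Z" Z \<I>] by (simp add: delta_bang_e)

text \<open>
  The tensor product of the cofree coalgebras \<open>!A\<close> and \<open>!B\<close> in the Eilenberg-Moore category.
\<close>

definition tensor_coalgebra
  where "tensor_coalgebra A B = (\<delta> A \<otimes> \<delta> B) \<Zsemi> m (bang\<^sub>0 A) (bang\<^sub>0 B)"

lemma source_target_tensor_coalgebra [simp]:
  "source C (tensor_coalgebra A B) = bang\<^sub>0 A \<otimes>\<^sub>0 bang\<^sub>0 B"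
  "target C (tensor_coalgebra A B) = bang\<^sub>0 (bang\<^sub>0 A \<otimes>\<^sub>0 bang\<^sub>0 B)"
  by (simp_all add: tensor_coalgebra_def)

lemma tensor_coalgebra_seq_eps [simp]:
  "tensor_coalgebra A B \<Zsemi> \<epsilon> (bang\<^sub>0 A \<otimes>\<^sub>0 bang\<^sub>0 B) = \<one> (bang\<^sub>0 A \<otimes>\<^sub>0 bang\<^sub>0 B)"
  by (simp add: tensor_coalgebra_def m_eps interchange)

lemma tensor_coalgebra_projection:
  "tensor_coalgebra A B \<Zsemi> bang (\<epsilon> A \<otimes> e B) = \<one> (bang\<^sub>0 A) \<otimes> e B"
  "tensor_coalgebra A B \<Zsemi> bang (e A \<otimes> \<epsilon> B) = e A \<otimes> \<one> (bang\<^sub>0 B)"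
proof -
  have "tensor_coalgebra A B \<Zsemi> bang (\<epsilon> A \<otimes> e B)
      = (\<delta> A \<otimes> \<delta> B) \<Zsemi> ((bang (\<epsilon> A) \<otimes> bang (e B)) \<Zsemi> m A \<I>)"
    using m_natural[of "\<epsilon> A" "bang\<^sub>0 A" A "e B" "bang\<^sub>0 B" \<I>]
    by (simp add: tensor_coalgebra_def in_hom_def)
  also have "\<dots> = (\<one> (bang\<^sub>0 A) \<otimes> e B) \<Zsemi> ((\<one> (bang\<^sub>0 A) \<otimes> m\<^sub>I) \<Zsemi> m A \<I>)"
    by (simp add: interchange_seq delta_bang_e)
  also have "\<dots> = \<one> (bang\<^sub>0 A) \<otimes> e B"
    by (simp add: m_unit_right)
  finally show "tensor_coalgebra A B \<Zsemi> bang (\<epsilon> A \<otimes> e B) = \<one> (bang\<^sub>0 A) \<otimes> e B" .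
  have "tensor_coalgebra A B \<Zsemi> bang (e A \<otimes> \<epsilon> B)
      = (\<delta> A \<otimes> \<delta> B) \<Zsemi> ((bang (e A) \<otimes> bang (\<epsilon> B)) \<Zsemi> m \<I> B)"
    using m_natural[of "e A" "bang\<^sub>0 A" \<I> "\<epsilon> B" "bang\<^sub>0 B" B]
    by (simp add: tensor_coalgebra_def in_hom_def)
  also have "\<dots> = (e A \<otimes> \<one> (bang\<^sub>0 B)) \<Zsemi> ((m\<^sub>I \<otimes> \<one> (bang\<^sub>0 B)) \<Zsemi> m \<I> B)"
    by (simp add: interchange_seq delta_bang_e)
  also have "\<dots> = e A \<otimes> \<one> (bang\<^sub>0 B)"
    by (simp add: m_unit_left)
  finally show "tensor_coalgebra A B \<Zsemi> bang (e A \<otimes> \<epsilon> B) = e A \<otimes> \<one> (bang\<^sub>0 B)" .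
qed

text \<open>
  The compatibility of \<open>m\<close> with \<open>\<Delta>\<close> says that \<open>m\<close> is a comonoid morphism, and \<open>\<delta>\<close> is one, too.
\<close>

lemma comonoid_morphism_tensor_coalgebra:
  "comonoid_morphism A B (bang\<^sub>0 A \<otimes>\<^sub>0 bang\<^sub>0 B) (tensor_coalgebra A B)"
  unfolding tensor_coalgebra_def
  by (rule comonoid_morphism_precompose[OF cofree_morphism_delta cofree_morphism_delta])
    (simp add: comonoid_morphism_def in_hom_def m_Delta)

lemma tensor_coalgebra_section:
  "tensor_coalgebra A B \<Zsemi> pair (bang\<^sub>0 A \<otimes>\<^sub>0 bang\<^sub>0 B) (bang (\<epsilon> A \<otimes> e B)) (bang (e A \<otimes> \<epsilon> B))
    = \<one> (bang\<^sub>0 A \<otimes>\<^sub>0 bang\<^sub>0 B)"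
  by (rule comonoid_morphism_seq_pair[OF comonoid_morphism_tensor_coalgebra])
    (simp_all add: tensor_coalgebra_projection)

end

locale additive_monoidal_coalgebra_modality =
  additive_symmetric_monoidal_category C +
  monoidal_coalgebra_modality C bang\<^sub>0 bang \<delta> \<epsilon> \<Delta> e m m\<^sub>I
  for C :: "('o, 'm, 'x) additive_smc_scheme" (structure)
    and bang\<^sub>0 bang \<delta> \<epsilon> \<Delta> e m m\<^sub>I
begin

text \<open>
  In the Eilenberg-Moore category \<open>!A \<otimes> !A\<close> is the product of \<open>!A\<close> with itself, and the coalgebra maps
  into \<open>!A\<close> form a commutative monoid, being in bijection with a homset of the additive category.
  So \<open>!A\<close> is a commutative monoid object whose operation corresponds to the sum of the projections.
\<close>

definition induced_nabla
  where "induced_nabla A = tensor_coalgebra A A \<Zsemi> bang ((e A \<otimes> \<epsilon> A) \<oplus> (\<epsilon> A \<otimes> e A))"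

definition induced_u where "induced_u A = m\<^sub>I \<Zsemi> bang (\<zero> \<I> A)"

lemma pointwise_induced:
  "pointwise_modality C bang\<^sub>0 bang \<delta> \<epsilon> \<Delta> e m m\<^sub>I induced_nabla induced_u"
proof unfold_locales
  fix Z A a b
  assume ab: "cofree_morphism Z A a" "cofree_morphism Z A b"
  have "cofree_morphism Z A ((pair Z (a \<Zsemi> \<delta> A) (b \<Zsemi> \<delta> A) \<Zsemi> m (bang\<^sub>0 A) (bang\<^sub>0 A))
      \<Zsemi> bang ((e A \<otimes> \<epsilon> A) \<oplus> (\<epsilon> A \<otimes> e A)))"
    using ab by (intro cofree_morphism_seq[OF cofree_morphism_pair_m cofree_morphism_bang]
        cofree_morphism_seq[OF _ cofree_morphism_delta]) simp_all
  then show "cofree_morphism Z A (pair Z a b \<Zsemi> induced_nabla A)"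
    using ab by (simp add: induced_nabla_def tensor_coalgebra_def)
next
  fix Z A
  have "cofree_morphism Z A ((e Z \<Zsemi> m\<^sub>I) \<Zsemi> bang (\<zero> \<I> A))"
    by (intro cofree_morphism_seq[OF cofree_morphism_e_mI cofree_morphism_bang]) simp_all
  then show "cofree_morphism Z A (e Z \<Zsemi> induced_u A)"
    by (simp add: induced_u_def)
next
  fix A
  have "induced_nabla A \<Zsemi> \<epsilon> A = (tensor_coalgebra A A \<Zsemi> \<epsilon> (bang\<^sub>0 A \<otimes>\<^sub>0 bang\<^sub>0 A))
      \<Zsemi> ((e A \<otimes> \<epsilon> A) \<oplus> (\<epsilon> A \<otimes> e A))"
    by (simp add: induced_nabla_def del: tensor_coalgebra_seq_eps)
  then show "induced_nabla A \<Zsemi> \<epsilon> A = (e A \<otimes> \<epsilon> A) \<oplus> (\<epsilon> A \<otimes> e A)"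
    by simp
  have "induced_u A \<Zsemi> \<epsilon> A = (m\<^sub>I \<Zsemi> \<epsilon> \<I>) \<Zsemi> \<zero> \<I> A"
    by (simp add: induced_u_def)
  then show "induced_u A \<Zsemi> \<epsilon> A = \<zero> \<I> A"
    by (simp add: mI_eps)
next
  fix A B
  show "\<exists>s. \<guillemotleft>s : bang\<^sub>0 A \<otimes>\<^sub>0 bang\<^sub>0 B \<rightarrow> bang\<^sub>0 (bang\<^sub>0 A \<otimes>\<^sub>0 bang\<^sub>0 B)\<guillemotright>
      \<and> s \<Zsemi> pair (bang\<^sub>0 A \<otimes>\<^sub>0 bang\<^sub>0 B) (bang (\<epsilon> A \<otimes> e B)) (bang (e A \<otimes> \<epsilon> B))
        = \<one> (bang\<^sub>0 A \<otimes>\<^sub>0 bang\<^sub>0 B)"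
    by (rule exI[of _ "tensor_coalgebra A B"]) (simp add: in_hom_def tensor_coalgebra_section)
  show "\<exists>s. \<guillemotleft>s : \<I> \<rightarrow> bang\<^sub>0 \<I>\<guillemotright> \<and> s \<Zsemi> e \<I> = \<one> \<I>"
    using mI_in_hom mI_e by blast
qed (simp_all add: cofree_morphism_pair_m cofree_morphism_e_mI m_eps mI_eps
    induced_nabla_def induced_u_def)

end

section \<open>Bialgebra modalities over an additive category\<close>

context bialgebra_modality
begin

lemma source_target_monoid [simp]:
  "source C (\<nabla> A) = bang\<^sub>0 A \<otimes>\<^sub>0 bang\<^sub>0 A" "target C (\<nabla> A) = bang\<^sub>0 A"
  "source C (u A) = \<I>" "target C (u A) = bang\<^sub>0 A"
  using nabla_in_hom u_in_hom by (auto simp: in_hom_def)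

lemma nabla_seq_bang:
  "source C f = X \<Longrightarrow> \<nabla> X \<Zsemi> bang f = (bang f \<otimes> bang f) \<Zsemi> \<nabla> (target C f)"
  using nabla_natural[of f] by (simp add: in_hom_def)

text \<open>
  The object \<open>!A \<otimes> !B\<close> has injections \<open>1 \<otimes> u\<close> and \<open>u \<otimes> 1\<close> of \<open>!A\<close> and \<open>!B\<close>; the map below sends
  \<open>exp a \<otimes> exp b\<close> to the exponential of the sum \<open>exp a \<otimes> 1 + 1 \<otimes> exp b\<close> of the two images.
\<close>

definition joint_injection
  where "joint_injection A B = ((\<delta> A \<Zsemi> bang (\<one> (bang\<^sub>0 A) \<otimes> u B))
    \<otimes> (\<delta> B \<Zsemi> bang (u A \<otimes> \<one> (bang\<^sub>0 B)))) \<Zsemi> \<nabla> (bang\<^sub>0 A \<otimes>\<^sub>0 bang\<^sub>0 B)"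

lemma source_target_joint_injection [simp]:
  "source C (joint_injection A B) = bang\<^sub>0 A \<otimes>\<^sub>0 bang\<^sub>0 B"
  "target C (joint_injection A B) = bang\<^sub>0 (bang\<^sub>0 A \<otimes>\<^sub>0 bang\<^sub>0 B)"
  by (simp_all add: joint_injection_def)

lemma joint_injection_seq_bang:
  assumes "source C f = bang\<^sub>0 A \<otimes>\<^sub>0 bang\<^sub>0 B"
  shows "joint_injection A B \<Zsemi> bang f
    = ((\<delta> A \<Zsemi> bang ((\<one> (bang\<^sub>0 A) \<otimes> u B) \<Zsemi> f))
      \<otimes> (\<delta> B \<Zsemi> bang ((u A \<otimes> \<one> (bang\<^sub>0 B)) \<Zsemi> f))) \<Zsemi> \<nabla> (target C f)"
  using assms by (simp add: joint_injection_def nabla_seq_bang interchange_seq bang_seq_eq)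

lemma comonoid_morphism_joint_injection:
  "comonoid_morphism A B (bang\<^sub>0 A \<otimes>\<^sub>0 bang\<^sub>0 B) (joint_injection A B)"
  unfolding joint_injection_def
  by (rule comonoid_morphism_precompose[of _ "bang\<^sub>0 A \<otimes>\<^sub>0 bang\<^sub>0 B" _ _ "bang\<^sub>0 A \<otimes>\<^sub>0 bang\<^sub>0 B"])
    (simp_all add: comonoid_morphism_def in_hom_def nabla_Delta cofree_morphism_delta_bang)

end

locale bialgebra_modality_over_additive =
  additive_symmetric_monoidal_category C + bialgebra_modality C bang\<^sub>0 bang \<delta> \<epsilon> \<Delta> e nabla u
  for C :: "('o, 'm, 'x) additive_smc_scheme" (structure)
    and bang\<^sub>0 bang \<delta> \<epsilon> \<Delta> e and nabla (\<open>\<nabla>\<close>) and u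
begin

text \<open>
  The unit is natural, hence invariant under \<open>!0\<close>, which becomes \<open>0\<close> when \<open>\<epsilon>\<close> is applied.
\<close>

lemma u_seq_eps [simp]: "u A \<Zsemi> \<epsilon> A = \<zero> \<I> A"
proof -
  have "u A \<Zsemi> \<epsilon> A = (u A \<Zsemi> bang (\<zero> A A)) \<Zsemi> \<epsilon> A"
    using u_natural[of "\<zero> A A" A A] by (simp add: in_hom_def)
  then show ?thesis
    by simp
qed

end

text \<open>
  The common ground of additive and monoidal bialgebra modalities: the law for \<open>!0\<close> is an axiom of
  the former, and the latter satisfy it because \<open>e\<close> and \<open>u\<close> are coalgebra maps. The law makes the
  unwanted component vanish when \<open>joint_injection\<close> is followed by a projection.
\<close>

locale zero_preserving_bialgebra_modality =
  bialgebra_modality_over_additive C bang\<^sub>0 bang \<delta> \<epsilon> \<Delta> e nabla u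
  for C :: "('o, 'm, 'x) additive_smc_scheme" (structure)
    and bang\<^sub>0 bang \<delta> \<epsilon> \<Delta> e and nabla (\<open>\<nabla>\<close>) and u +
  assumes bang_zero_eq: "bang (\<zero> X Y) = e X \<Zsemi> u Y"
begin

lemma delta_bang_zero: "\<delta> A \<Zsemi> bang (\<zero> (bang\<^sub>0 A) B) = e A \<Zsemi> u B"
proof -
  have "\<delta> A \<Zsemi> bang (\<zero> (bang\<^sub>0 A) B) = (\<delta> A \<Zsemi> e (bang\<^sub>0 A)) \<Zsemi> u B"
    by (simp add: bang_zero_eq del: delta_e)
  then show ?thesis
    by simp
qed

lemma injection_projection:
  "(\<one> (bang\<^sub>0 A) \<otimes> u B) \<Zsemi> (\<epsilon> A \<otimes> e B) = \<epsilon> A"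
  "(u A \<otimes> \<one> (bang\<^sub>0 B)) \<Zsemi> (\<epsilon> A \<otimes> e B) = \<zero> (bang\<^sub>0 B) A"
  "(\<one> (bang\<^sub>0 A) \<otimes> u B) \<Zsemi> (e A \<otimes> \<epsilon> B) = \<zero> (bang\<^sub>0 A) B"
  "(u A \<otimes> \<one> (bang\<^sub>0 B)) \<Zsemi> (e A \<otimes> \<epsilon> B) = \<epsilon> B"
  by (simp_all add: interchange u_e)

lemma joint_injection_projection:
  "joint_injection A B \<Zsemi> bang (\<epsilon> A \<otimes> e B) = \<one> (bang\<^sub>0 A) \<otimes> e B"
  "joint_injection A B \<Zsemi> bang (e A \<otimes> \<epsilon> B) = e A \<otimes> \<one> (bang\<^sub>0 B)"
proof -
  have "joint_injection A B \<Zsemi> bang (\<epsilon> A \<otimes> e B) = (\<one> (bang\<^sub>0 A) \<otimes> (e B \<Zsemi> u A)) \<Zsemi> \<nabla> A"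
    by (simp add: joint_injection_seq_bang injection_projection delta_bang_zero)
  also have "\<dots> = (\<one> (bang\<^sub>0 A) \<otimes> e B) \<Zsemi> ((\<one> (bang\<^sub>0 A) \<otimes> u A) \<Zsemi> \<nabla> A)"
    by (simp add: interchange_seq)
  finally show "joint_injection A B \<Zsemi> bang (\<epsilon> A \<otimes> e B) = \<one> (bang\<^sub>0 A) \<otimes> e B"
    by (simp add: nabla_unit_right)
  have "joint_injection A B \<Zsemi> bang (e A \<otimes> \<epsilon> B) = ((e A \<Zsemi> u B) \<otimes> \<one> (bang\<^sub>0 B)) \<Zsemi> \<nabla> B"
    by (simp add: joint_injection_seq_bang injection_projection delta_bang_zero)
  also have "\<dots> = (e A \<otimes> \<one> (bang\<^sub>0 B)) \<Zsemi> ((u B \<otimes> \<one> (bang\<^sub>0 B)) \<Zsemi> \<nabla> B)"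
    by (simp add: interchange_seq)
  finally show "joint_injection A B \<Zsemi> bang (e A \<otimes> \<epsilon> B) = e A \<otimes> \<one> (bang\<^sub>0 B)"
    by (simp add: nabla_unit_left)
qed

lemma joint_injection_section:
  "joint_injection A B
      \<Zsemi> pair (bang\<^sub>0 A \<otimes>\<^sub>0 bang\<^sub>0 B) (bang (\<epsilon> A \<otimes> e B)) (bang (e A \<otimes> \<epsilon> B))
    = \<one> (bang\<^sub>0 A \<otimes>\<^sub>0 bang\<^sub>0 B)"
  by (rule comonoid_morphism_seq_pair[OF comonoid_morphism_joint_injection])
    (simp_all add: joint_injection_projection)

text \<open>
  An argument of Eckmann-Hilton type. Let \<open>p\<close> and \<open>q\<close> be the two projections \<open>!A \<otimes> !A \<rightarrow> A\<close> and \<open>s\<close>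
  the section. By naturality \<open>\<nabla> A = s \<Zsemi> !(p + q)\<close>, so that \<open>\<nabla> A \<Zsemi> \<epsilon> A = s \<Zsemi> \<epsilon>
      \<Zsemi> (p + q)\<close>. This
  distributes over the sum, and \<open>s \<Zsemi> \<epsilon> \<Zsemi> p = s \<Zsemi> !p \<Zsemi> \<epsilon> = p\<close>, likewise for \<open>q\<close>.
\<close>

lemma nabla_seq_eps: "\<nabla> A \<Zsemi> \<epsilon> A = (e A \<otimes> \<epsilon> A) \<oplus> (\<epsilon> A \<otimes> e A)"
proof -
  let ?p = "\<epsilon> A \<otimes> e A" and ?q = "e A \<otimes> \<epsilon> A"
  have sum: "joint_injection A A \<Zsemi> bang (?p \<oplus> ?q) = \<nabla> A"
    by (simp add: joint_injection_seq_bang seq_add_eq injection_projection)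
  have p: "joint_injection A A \<Zsemi> (\<epsilon> (bang\<^sub>0 A \<otimes>\<^sub>0 bang\<^sub>0 A) \<Zsemi> ?p) = ?p"
  proof -
    have "joint_injection A A \<Zsemi> (\<epsilon> (bang\<^sub>0 A \<otimes>\<^sub>0 bang\<^sub>0 A) \<Zsemi> ?p)
        = (joint_injection A A \<Zsemi> bang ?p) \<Zsemi> \<epsilon> A"
      by simp
    then show ?thesis
      by (simp only: joint_injection_projection) (simp add: tensor_scalar_right)
  qed
  have q: "joint_injection A A \<Zsemi> (\<epsilon> (bang\<^sub>0 A \<otimes>\<^sub>0 bang\<^sub>0 A) \<Zsemi> ?q) = ?q"
  proof -
    have "joint_injection A A \<Zsemi> (\<epsilon> (bang\<^sub>0 A \<otimes>\<^sub>0 bang\<^sub>0 A) \<Zsemi> ?q)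
        = (joint_injection A A \<Zsemi> bang ?q) \<Zsemi> \<epsilon> A"
      by simp
    then show ?thesis
      by (simp only: joint_injection_projection) (simp add: tensor_scalar_left)
  qed
  have "\<nabla> A \<Zsemi> \<epsilon> A = joint_injection A A \<Zsemi> (\<epsilon> (bang\<^sub>0 A \<otimes>\<^sub>0 bang\<^sub>0 A) \<Zsemi> (?p \<oplus> ?q))"
    by (simp add: sum[symmetric])
  also have "\<dots> = ?p \<oplus> ?q"
    by (simp add: seq_add_eq p q)
  also have "\<dots> = ?q \<oplus> ?p"
    by (rule add_commute_eq) simp_all
  finally show ?thesis .
qed

end

section \<open>Monoidal bialgebra modalities\<close>

locale additive_monoidal_bialgebra_modality =
  additive_symmetric_monoidal_category C +
  monoidal_bialgebra_modality C bang\<^sub>0 bang \<delta> \<epsilon> \<Delta> e m m\<^sub>I nabla u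
  for C :: "('o, 'm, 'x) additive_smc_scheme" (structure)
    and bang\<^sub>0 bang \<delta> \<epsilon> \<Delta> e m m\<^sub>I and nabla (\<open>\<nabla>\<close>) and u
begin

lemma cofree_morphism_e_u: "cofree_morphism Z A (e Z \<Zsemi> u A)"
proof (rule cofree_morphismI)
  have "(e Z \<Zsemi> u A) \<Zsemi> \<delta> A = (\<delta> Z \<Zsemi> bang (e Z)) \<Zsemi> bang (u A)"
    by (simp add: u_delta delta_bang_e)
  then show "(e Z \<Zsemi> u A) \<Zsemi> \<delta> A = \<delta> Z \<Zsemi> bang (e Z \<Zsemi> u A)"
    by (simp add: bang_seq_eq)
qed simp_all

sublocale bialgebra_modality_over_additive C bang\<^sub>0 bang \<delta> \<epsilon> \<Delta> e nabla u ..

sublocale zero_preserving_bialgebra_modality C bang\<^sub>0 bang \<delta> \<epsilon> \<Delta> e nabla u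
proof
  show "bang (\<zero> X Y) = e X \<Zsemi> u Y" for X Y
    by (rule cofree_morphism_ext[OF cofree_morphism_bang cofree_morphism_e_u]) simp_all
qed

text \<open>
  The pairing \<open>\<langle>a, b\<rangle>\<close> is a coalgebra map into the tensor coalgebra on \<open>!A \<otimes> !A\<close>, and compatibility of
  \<open>\<nabla>\<close> with \<open>\<delta>\<close> says that \<open>\<nabla>\<close> is a coalgebra map out of it.
\<close>

lemma cofree_morphism_pair_nabla:
  assumes a: "cofree_morphism Z A a" and b: "cofree_morphism Z A b"
  shows "cofree_morphism Z A (pair Z a b \<Zsemi> \<nabla> A)"
proof (rule cofree_morphismI)
  have ab: "pair Z (a \<Zsemi> \<delta> A) (b \<Zsemi> \<delta> A) \<Zsemi> m (bang\<^sub>0 A) (bang\<^sub>0 A) = \<delta> Z \<Zsemi> bang (pair Z a b)"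
  proof (rule cofree_morphism_ext)
    show "cofree_morphism Z (bang\<^sub>0 A \<otimes>\<^sub>0 bang\<^sub>0 A)
        (pair Z (a \<Zsemi> \<delta> A) (b \<Zsemi> \<delta> A) \<Zsemi> m (bang\<^sub>0 A) (bang\<^sub>0 A))"
      by (intro cofree_morphism_pair_m cofree_morphism_seq[OF a cofree_morphism_delta]
          cofree_morphism_seq[OF b cofree_morphism_delta])
    show "cofree_morphism Z (bang\<^sub>0 A \<otimes>\<^sub>0 bang\<^sub>0 A) (\<delta> Z \<Zsemi> bang (pair Z a b))"
      using a b by (intro cofree_morphism_delta_bang) simp_all
  qed (use a b in \<open>simp add: m_eps\<close>)
  have "(pair Z a b \<Zsemi> \<nabla> A) \<Zsemi> \<delta> A
      = (pair Z (a \<Zsemi> \<delta> A) (b \<Zsemi> \<delta> A) \<Zsemi> m (bang\<^sub>0 A) (bang\<^sub>0 A)) \<Zsemi> bang (\<nabla> A)"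
    using a b by (simp add: nabla_delta)
  then show "(pair Z a b \<Zsemi> \<nabla> A) \<Zsemi> \<delta> A = \<delta> Z \<Zsemi> bang (pair Z a b \<Zsemi> \<nabla> A)"
    unfolding ab using a b by (simp add: bang_seq_eq)
qed (use a b in simp_all)

lemma pointwise: "pointwise_modality C bang\<^sub>0 bang \<delta> \<epsilon> \<Delta> e m m\<^sub>I nabla u"
proof unfold_locales
  fix A B
  show "\<exists>s. \<guillemotleft>s : bang\<^sub>0 A \<otimes>\<^sub>0 bang\<^sub>0 B \<rightarrow> bang\<^sub>0 (bang\<^sub>0 A \<otimes>\<^sub>0 bang\<^sub>0 B)\<guillemotright>
      \<and> s \<Zsemi> pair (bang\<^sub>0 A \<otimes>\<^sub>0 bang\<^sub>0 B) (bang (\<epsilon> A \<otimes> e B)) (bang (e A \<otimes> \<epsilon> B))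
        = \<one> (bang\<^sub>0 A \<otimes>\<^sub>0 bang\<^sub>0 B)"
    by (rule exI[of _ "joint_injection A B"]) (simp add: in_hom_def joint_injection_section)
  show "\<exists>s. \<guillemotleft>s : \<I> \<rightarrow> bang\<^sub>0 \<I>\<guillemotright> \<and> s \<Zsemi> e \<I> = \<one> \<I>"
    using mI_in_hom mI_e by blast
qed (simp_all add: cofree_morphism_pair_m cofree_morphism_e_mI cofree_morphism_pair_nabla
    cofree_morphism_e_u m_eps mI_eps nabla_seq_eps)

end

section \<open>Additive bialgebra modalities\<close>

context additive_bialgebra_modality
begin

sublocale bialgebra_modality_over_additive C bang\<^sub>0 bang \<delta> \<epsilon> \<Delta> e nabla u ..

sublocale zero_preserving_bialgebra_modality C bang\<^sub>0 bang \<delta> \<epsilon> \<Delta> e nabla u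
  by unfold_locales (rule bang_zero)

text \<open>
  The axiom for \<open>!(f + g)\<close> says that \<open>exp a \<cdot> exp b = exp (a + b)\<close>: the composite is \<open>\<delta>\<close> followed by
  \<open>!(a \<Zsemi> \<epsilon> + b \<Zsemi> \<epsilon>)\<close>.
\<close>

lemma cofree_morphism_pair_nabla:
  assumes a: "cofree_morphism Z A a" and b: "cofree_morphism Z A b"
  shows "cofree_morphism Z A (pair Z a b \<Zsemi> \<nabla> A)"
proof -
  define f g where "f = a \<Zsemi> \<epsilon> A" and "g = b \<Zsemi> \<epsilon> A"
  have fg: "source C f = bang\<^sub>0 Z" "target C f = A" "source C g = bang\<^sub>0 Z" "target C g = A"
    using a b by (simp_all add: f_def g_def)
  have "pair Z a b \<Zsemi> \<nabla> A = pair Z (\<delta> Z \<Zsemi> bang f) (\<delta> Z \<Zsemi> bang g) \<Zsemi> \<nabla> A"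
    unfolding f_def g_def
    by (simp only: cofree_morphism_eq_delta_bang[OF a, symmetric]
        cofree_morphism_eq_delta_bang[OF b, symmetric])
  also have "\<dots> = (\<delta> Z \<Zsemi> pair (bang\<^sub>0 Z) (bang f) (bang g)) \<Zsemi> \<nabla> A"
    using fg by (simp only: cofree_morphism_pair[OF cofree_morphism_delta] source_target_bang)
  also have "\<dots> = \<delta> Z \<Zsemi> (pair (bang\<^sub>0 Z) (bang f) (bang g) \<Zsemi> \<nabla> A)"
    using fg by (subst seq_seq) simp_all
  also have "\<dots> = \<delta> Z \<Zsemi> bang (f \<oplus> g)"
    using fg bang_add[of f "bang\<^sub>0 Z" A g] by (simp add: in_hom_def pair_def)
  finally show ?thesis
    using fg by (simp add: cofree_morphism_delta_bang)
qed

lemma cofree_morphism_e_u: "cofree_morphism Z A (e Z \<Zsemi> u A)"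
  using cofree_morphism_bang[of "\<zero> Z A" Z A] by (simp add: bang_zero)

text \<open>
  On exponentials: \<open>exp a \<otimes> exp b\<close> is sent by the section to \<open>exp z\<close> with
  \<open>z = exp a \<otimes> 1 + 1 \<otimes> exp b\<close>, whose coordinates are \<open>exp a\<close> and \<open>exp b\<close>. The map \<open>\<delta> \<Zsemi> !h\<close> sends
  \<open>exp z\<close> to \<open>exp (h (exp z))\<close>, and here \<open>h\<close> reads off the coordinates and applies \<open>\<epsilon> \<otimes> \<epsilon>\<close> to
  them, which yields \<open>exp (a \<otimes> b)\<close>.
\<close>

definition induced_m
  where "induced_m A B = joint_injection A B \<Zsemi> (\<delta> (bang\<^sub>0 A \<otimes>\<^sub>0 bang\<^sub>0 B)
    \<Zsemi> bang (pair (bang\<^sub>0 A \<otimes>\<^sub>0 bang\<^sub>0 B) (bang (\<epsilon> A \<otimes> e B)) (bang (e A \<otimes> \<epsilon> B))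
        \<Zsemi> (\<epsilon> A \<otimes> \<epsilon> B)))"

text \<open>
  In the same way \<open>exp 0\<close> is sent to the exponential of \<open>e (exp 0) = 1\<close>.
\<close>

definition induced_mI where "induced_mI = u \<I> \<Zsemi> (\<delta> \<I> \<Zsemi> bang (e \<I>))"

lemma pointwise_induced:
  "pointwise_modality C bang\<^sub>0 bang \<delta> \<epsilon> \<Delta> e induced_m induced_mI nabla u"
proof unfold_locales
  fix Z A B a b
  assume a: "cofree_morphism Z A a" and b: "cofree_morphism Z B b"
  let ?W = "bang\<^sub>0 A \<otimes>\<^sub>0 bang\<^sub>0 B"
  have "cofree_morphism Z ?W (pair Z a b \<Zsemi> joint_injection A B)"
  proof -
    have "cofree_morphism Z ?W (pair Z (a \<Zsemi> (\<delta> A \<Zsemi> bang (\<one> (bang\<^sub>0 A) \<otimes> u B)))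
        (b \<Zsemi> (\<delta> B \<Zsemi> bang (u A \<otimes> \<one> (bang\<^sub>0 B)))) \<Zsemi> \<nabla> ?W)"
      by (intro cofree_morphism_pair_nabla cofree_morphism_seq[OF a] cofree_morphism_seq[OF b]
          cofree_morphism_delta_bang) simp_all
    then show ?thesis
      using a b by (simp add: joint_injection_def)
  qed
  then have "cofree_morphism Z (A \<otimes>\<^sub>0 B) ((pair Z a b \<Zsemi> joint_injection A B) \<Zsemi> (\<delta> ?W
      \<Zsemi> bang (pair ?W (bang (\<epsilon> A \<otimes> e B)) (bang (e A \<otimes> \<epsilon> B))
          \<Zsemi> (\<epsilon> A \<otimes> \<epsilon> B))))"
    by (rule cofree_morphism_seq) (rule cofree_morphism_delta_bang, simp_all)
  then show "cofree_morphism Z (A \<otimes>\<^sub>0 B) (pair Z a b \<Zsemi> induced_m A B)"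
    using a b by (simp add: induced_m_def)
next
  fix Z
  have "cofree_morphism Z \<I> ((e Z \<Zsemi> u \<I>) \<Zsemi> (\<delta> \<I> \<Zsemi> bang (e \<I>)))"
    by (rule cofree_morphism_seq[OF cofree_morphism_e_u]) (rule cofree_morphism_delta_bang, simp_all)
  then show "cofree_morphism Z \<I> (e Z \<Zsemi> induced_mI)"
    by (simp add: induced_mI_def)
next
  fix A B
  let ?W = "bang\<^sub>0 A \<otimes>\<^sub>0 bang\<^sub>0 B"
  let ?r = "pair ?W (bang (\<epsilon> A \<otimes> e B)) (bang (e A \<otimes> \<epsilon> B))"
  have "induced_m A B \<Zsemi> \<epsilon> (A \<otimes>\<^sub>0 B) = (joint_injection A B \<Zsemi> ?r)
      \<Zsemi> (\<epsilon> A \<otimes> \<epsilon> B)"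
    by (simp add: induced_m_def)
  then show "induced_m A B \<Zsemi> \<epsilon> (A \<otimes>\<^sub>0 B) = \<epsilon> A \<otimes> \<epsilon> B"
    by (simp only: joint_injection_section) simp
  show "\<exists>s. \<guillemotleft>s : ?W \<rightarrow> bang\<^sub>0 ?W\<guillemotright> \<and> s \<Zsemi> ?r = \<one> ?W"
    by (rule exI[of _ "joint_injection A B"]) (simp add: in_hom_def joint_injection_section)
next
  show "induced_mI \<Zsemi> \<epsilon> \<I> = \<one> \<I>"
    by (simp add: induced_mI_def u_e)
  show "\<exists>s. \<guillemotleft>s : \<I> \<rightarrow> bang\<^sub>0 \<I>\<guillemotright> \<and> s \<Zsemi> e \<I> = \<one> \<I>"
    using u_in_hom u_e by blast
qed (simp_all add: cofree_morphism_pair_nabla cofree_morphism_e_u nabla_eps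
    induced_m_def induced_mI_def)

end

section \<open>The correspondence\<close>

context additive_symmetric_monoidal_category
begin

lemma monoidal_bialgebra_modality_iff_pointwise:
  "monoidal_bialgebra_modality C bang\<^sub>0 bang \<delta> \<epsilon> \<Delta> e m m\<^sub>I nabla u
    \<longleftrightarrow> pointwise_modality C bang\<^sub>0 bang \<delta> \<epsilon> \<Delta> e m m\<^sub>I nabla u"
proof
  assume "monoidal_bialgebra_modality C bang\<^sub>0 bang \<delta> \<epsilon> \<Delta> e m m\<^sub>I nabla u"
  then interpret additive_monoidal_bialgebra_modality C bang\<^sub>0 bang \<delta> \<epsilon> \<Delta> e m m\<^sub>I nabla u
    by (intro additive_monoidal_bialgebra_modality.intro additive_symmetric_monoidal_category_axioms)
  show "pointwise_modality C bang\<^sub>0 bang \<delta> \<epsilon> \<Delta> e m m\<^sub>I nabla u"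
    by (rule pointwise)
next
  assume "pointwise_modality C bang\<^sub>0 bang \<delta> \<epsilon> \<Delta> e m m\<^sub>I nabla u"
  then show "monoidal_bialgebra_modality C bang\<^sub>0 bang \<delta> \<epsilon> \<Delta> e m m\<^sub>I nabla u"
    by (rule pointwise_modality.monoidal_bialgebra_modality)
qed

lemma monoidal_coalgebra_modality_iff_pointwise:
  "monoidal_coalgebra_modality C bang\<^sub>0 bang \<delta> \<epsilon> \<Delta> e m m\<^sub>I
    \<longleftrightarrow> (\<exists>nabla u. pointwise_modality C bang\<^sub>0 bang \<delta> \<epsilon> \<Delta> e m m\<^sub>I nabla u)"
proof
  assume "monoidal_coalgebra_modality C bang\<^sub>0 bang \<delta> \<epsilon> \<Delta> e m m\<^sub>I"
  then interpret additive_monoidal_coalgebra_modality C bang\<^sub>0 bang \<delta> \<epsilon> \<Delta> e m m\<^sub>I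
    by (intro additive_monoidal_coalgebra_modality.intro additive_symmetric_monoidal_category_axioms)
  show "\<exists>nabla u. pointwise_modality C bang\<^sub>0 bang \<delta> \<epsilon> \<Delta> e m m\<^sub>I nabla u"
    using pointwise_induced by blast
qed (blast intro: pointwise_modality.monoidal_coalgebra_modality)

lemma additive_bialgebra_modality_iff_pointwise:
  "additive_bialgebra_modality C bang\<^sub>0 bang \<delta> \<epsilon> \<Delta> e nabla u
    \<longleftrightarrow> (\<exists>m m\<^sub>I. pointwise_modality C bang\<^sub>0 bang \<delta> \<epsilon> \<Delta> e m m\<^sub>I nabla u)"
  by (blast intro: additive_bialgebra_modality.pointwise_induced
      pointwise_modality.additive_bialgebra_modality)

lemma bij_betw_forget_monoid:
  "bij_betw (\<lambda>(K, M, N). (K, M)) (monoidal_bialgebra_modalities C) (monoidal_coalgebra_modalities C)"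
proof (rule bij_betw_imageI)
  show "inj_on (\<lambda>(K, M, N). (K, M)) (monoidal_bialgebra_modalities C)"
    by (auto simp: inj_on_def monoidal_bialgebra_modalities_def
        monoidal_bialgebra_modality_iff_pointwise dest: pointwise_modality_unique)
  show "(\<lambda>(K, M, N). (K, M)) ` monoidal_bialgebra_modalities C = monoidal_coalgebra_modalities C"
    by (force simp: image_def monoidal_bialgebra_modalities_def monoidal_coalgebra_modalities_def
        monoidal_bialgebra_modality_iff_pointwise monoidal_coalgebra_modality_iff_pointwise)
qed

lemma bij_betw_forget_monoidal:
  "bij_betw (\<lambda>(K, M, N). (K, N)) (monoidal_bialgebra_modalities C) (additive_bialgebra_modalities C)"
proof (rule bij_betw_imageI)
  show "inj_on (\<lambda>(K, M, N). (K, N)) (monoidal_bialgebra_modalities C)"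
    by (auto simp: inj_on_def monoidal_bialgebra_modalities_def
        monoidal_bialgebra_modality_iff_pointwise dest: pointwise_modality_unique)
  show "(\<lambda>(K, M, N). (K, N)) ` monoidal_bialgebra_modalities C = additive_bialgebra_modalities C"
    by (force simp: image_def monoidal_bialgebra_modalities_def additive_bialgebra_modalities_def
        monoidal_bialgebra_modality_iff_pointwise additive_bialgebra_modality_iff_pointwise)
qed

end

theorem theorem6p5:
  fixes C :: "('o, 'm, 'x) additive_smc_scheme"
  assumes "additive_symmetric_monoidal_category C"
  shows "bij_betw (\<lambda>(K, M, N). (K, M))
           (monoidal_bialgebra_modalities C) (monoidal_coalgebra_modalities C)
    \<and> bij_betw (\<lambda>(K, M, N). (K, N))
           (monoidal_bialgebra_modalities C) (additive_bialgebra_modalities C)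
    \<and> (\<exists>\<Phi>. bij_betw \<Phi> (monoidal_coalgebra_modalities C) (additive_bialgebra_modalities C)
           \<and> (\<forall>(K, M, N) \<in> monoidal_bialgebra_modalities C. \<Phi> (K, M) = (K, N)))"
proof -
  interpret additive_symmetric_monoidal_category C
    by (fact assms)
  let ?B = "monoidal_bialgebra_modalities C"
  let ?f = "\<lambda>(K :: ('o, 'm) coalgebra_data, M :: ('o, 'm) monoidal_data, N :: ('o, 'm) bialgebra_data). (K, M)"
  let ?g = "\<lambda>(K :: ('o, 'm) coalgebra_data, M :: ('o, 'm) monoidal_data, N :: ('o, 'm) bialgebra_data). (K, N)"
  define \<Phi> where "\<Phi> = ?g \<circ> the_inv_into ?B ?f"
  have "bij_betw \<Phi> (monoidal_coalgebra_modalities C) (additive_bialgebra_modalities C)"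
    unfolding \<Phi>_def
    by (rule bij_betw_trans[OF bij_betw_the_inv_into[OF bij_betw_forget_monoid]
          bij_betw_forget_monoidal])
  moreover have "\<Phi> (?f x) = ?g x" if "x \<in> ?B" for x
    using the_inv_into_f_f[OF bij_betw_imp_inj_on[OF bij_betw_forget_monoid] that]
    by (simp add: \<Phi>_def)
  then have "\<forall>(K, M, N) \<in> ?B. \<Phi> (K, M) = (K, N)"
    by fastforce
  ultimately show ?thesis
    using bij_betw_forget_monoid bij_betw_forget_monoidal by blast
qed

end
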